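(* Let $l_a,l_b>0$. For every pair of real-valued local potentials $V_a\in L^1(0,l_a)$, $V_b\in L^1(0,l_b)$, there are $E_0\in\mathbb{R}$ and $C>0$ such that for every $\omega\in\Omega_{\rm TM}$, $$\|M_\omega(x,y,E_0)\|\le C\quad\text{for all }x,y\in\mathbb{R}.$$
   Context: The Thue-Morse substitution on the alphabet $\{a,b\}$ is $S(a)=ab$, $S(b)=ba$, extended to words by concatenation. The associated two-sided subshift is $$\Omega_{\rm TM}=\{\omega\in\{a,b\}^{\mathbb{Z}}:\ \text{every finite subword of }\omega\text{ is contained in }S^n(a)\text{ for some }n\ge 1\}.$$ Each $\omega\in\Omega_{\rm TM}$ generates a potential $V_\omega$ on $\mathbb{R}$ by concatenating local potentials: $V_\omega(x)=V_{\omega_0}(x)$ on $(0,l_{\omega_0})$, $V_\omega(x)=V_{\omega_1}(x-l_{\omega_0})$ on $(l_{\omega_0},l_{\omega_0}+l_{\omega_1})$, etc., and similarly on the left half-line using $\omega_{-1},\omega_{-2},\dots$ (so $V_{\omega_{-1}}$ is placed on $(-l_{\omega_{-1}},0)$, and so on). $M_\omega(x,y,E)$ is the transfer matrix: the unique $2\times2$ matrix with $M_\omega(x,y,E)(u(y),u'(y))^t=(u(x),u'(x))^t$ for every solution $u$ of $-u''+V_\omega u=Eu$. *)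

theory Defs
  imports "HOL-Analysis.Analysis" "HOL-Library.Sublist"
begin

section \<open>The Thue--Morse subshift\<close>

datatype letter = A | B

fun TM_letter :: "letter \<Rightarrow> letter list" where
  "TM_letter A = [A, B]"
| "TM_letter B = [B, A]"

definition TM_subst :: "letter list \<Rightarrow> letter list" where
  "TM_subst w = concat (map TM_letter w)"

text \<open>\<^const>\<open>sublist\<close> is the contiguous-factor relation, and \<open>[i..j]\<close> lists the integers
  from \<open>i\<close> to \<open>j\<close>, so \<open>map \<omega> [i..j]\<close> ranges over all finite subwords of \<open>\<omega>\<close>.\<close>

definition Omega_TM :: "(int \<Rightarrow> letter) set" where
  "Omega_TM = {\<omega>. \<forall>i j. \<exists>n\<ge>1. sublist (map \<omega> [i..j]) ((TM_subst ^^ n) [A])}"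


section \<open>Potentials by concatenation\<close>

text \<open>The block belonging to \<open>\<omega> n\<close> has left endpoint \<open>block_start l \<omega> n\<close> and
  right endpoint \<open>block_start l \<omega> (n + 1)\<close>; the block of \<open>\<omega> 0\<close> starts at the origin.\<close>

definition block_start :: "(letter \<Rightarrow> real) \<Rightarrow> (int \<Rightarrow> letter) \<Rightarrow> int \<Rightarrow> real" where
  "block_start l \<omega> n =
     (if 0 \<le> n then \<Sum>k\<in>{0..<n}. l (\<omega> k) else - (\<Sum>k\<in>{n..<0}. l (\<omega> k)))"

text \<open>For positive block lengths there is exactly one block containing \<open>x\<close>. The blocks are
  taken half-open; the values at the block endpoints form a null set and are irrelevant.\<close>

definition block_index :: "(letter \<Rightarrow> real) \<Rightarrow> (int \<Rightarrow> letter) \<Rightarrow> real \<Rightarrow> int" where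
  "block_index l \<omega> x = (THE n. block_start l \<omega> n \<le> x \<and> x < block_start l \<omega> (n + 1))"

definition potential ::
    "(letter \<Rightarrow> real) \<Rightarrow> (letter \<Rightarrow> real \<Rightarrow> real) \<Rightarrow> (int \<Rightarrow> letter) \<Rightarrow> real \<Rightarrow> real" where
  "potential l V \<omega> x =
     (let n = block_index l \<omega> x in V (\<omega> n) (x - block_start l \<omega> n))"


section \<open>Schroedinger equation and transfer matrices\<close>

text \<open>The usual \<open>\<epsilon>\<close>-\<open>\<delta>\<close> definition of absolute continuity; a finite family of non-overlapping
  compact subintervals is a set \<open>D\<close> that is a division of its own union.\<close>

definition abs_cont_on_interval :: "real \<Rightarrow> real \<Rightarrow> (real \<Rightarrow> real) \<Rightarrow> bool" where
  "abs_cont_on_interval a b f \<longleftrightarrow>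
     (\<forall>\<epsilon>>0. \<exists>\<delta>>0. \<forall>D. D division_of \<Union>D \<and> \<Union>D \<subseteq> {a..b} \<and> (\<Sum>K\<in>D. Sup K - Inf K) < \<delta>
        \<longrightarrow> (\<Sum>K\<in>D. \<bar>f (Sup K) - f (Inf K)\<bar>) < \<epsilon>)"

definition locally_abs_cont :: "(real \<Rightarrow> real) \<Rightarrow> bool" where
  "locally_abs_cont f \<longleftrightarrow> (\<forall>a b. abs_cont_on_interval a b f)"

text \<open>Solutions of \<open>- u'' + V u = E u\<close> for \<open>V\<close> locally integrable: \<open>u\<close> and \<open>u'\<close> are locally
  absolutely continuous and the equation holds almost everywhere. As \<open>u'\<close> is continuous, \<open>u\<close> is
  differentiable at every point and its own local absolute continuity is automatic.\<close>

definition schroedinger_solution :: "(real \<Rightarrow> real) \<Rightarrow> real \<Rightarrow> (real \<Rightarrow> real) \<Rightarrow> bool" where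
  "schroedinger_solution V E u \<longleftrightarrow>
     (\<forall>x. u differentiable at x) \<and> locally_abs_cont (deriv u) \<and>
     (AE x in lebesgue. deriv u differentiable at x \<and>
        - deriv (deriv u) x + V x * u x = E * u x)"

definition transfer_matrix ::
    "(letter \<Rightarrow> real) \<Rightarrow> (letter \<Rightarrow> real \<Rightarrow> real) \<Rightarrow> (int \<Rightarrow> letter)
       \<Rightarrow> real \<Rightarrow> real \<Rightarrow> real \<Rightarrow> real^2^2" where
  "transfer_matrix l V \<omega> x y E =
     (THE M. \<forall>u. schroedinger_solution (potential l V \<omega>) E u \<longrightarrow>
        M *v vector [u y, deriv u y] = vector [u x, deriv u x])"

end

theory Submission
  imports Defs
begin

text \<open>At an energy \<open>E\<close> with \<open>tr (M\<^sub>b M\<^sub>a) = 0\<close>, where \<open>M\<^sub>a\<close> and \<open>M\<^sub>b\<close> are the unimodular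
  one-letter transfer matrices, both \<open>X = M\<^sub>b M\<^sub>a\<close> and \<open>Y = M\<^sub>a M\<^sub>b\<close> square to \<open>-1\<close>. Hence the
  transfer matrices \<open>X Y Y X\<close> and \<open>Y X X Y\<close> of the third substitution words of both letters are the
  identity. Every subword of an element of the subshift sits in a concatenation of such words, so its
  transfer matrix is a product of boundedly many letter matrices and their inverses.

  Such an energy exists by the intermediate value theorem: \<open>tr (M\<^sub>b M\<^sub>a)\<close> is continuous in \<open>E\<close>, and by
  variation of parameters it differs from \<open>2 cos (k (l\<^sub>a + l\<^sub>b))\<close> by \<open>O(1/k)\<close> for \<open>E = k\<^sup>2\<close>.\<close>

section \<open>Absolutely continuous functions\<close>

text \<open>The square -1 is Cayley-Hamilton with determinant 1 and trace 0, and one trace condition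
  serves both orders of the letters because the trace of a product is cyclic. The energy and the
  letter matrices depend on \<open>l\<close> and \<open>V\<close> alone, whence a bound uniform in
  the sequence.

  The obstacle is that the potentials are merely integrable. \<open>schroedinger_solution\<close>
  asks for absolute continuity in \<epsilon>-\<delta> form and for derivatives almost everywhere, so
  both directions of the fundamental theorem of calculus for the Lebesgue integral come before any
  Wronskian can be differentiated or integrated. Moreover \<open>transfer_matrix\<close> is a
  definite description: it is pinned down only by two independent solutions on the whole line, hence
  the global existence theorem. \<open>ac_primitive\<close> is the working notion of indefinite
  integral; it obeys the product and chain rules, so that Wronskian computations read as in the
  smooth case.\<close>

definition ac_primitive :: "(real \<Rightarrow> real) \<Rightarrow> (real \<Rightarrow> real) \<Rightarrow> bool" where
  "ac_primitive F f \<longleftrightarrow> locally_abs_cont F \<and> (AE x in lebesgue. (F has_real_derivative f x) (at x))"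

text \<open>Riemann sums are controlled by the derivative at tags outside \<open>N\<close>; for tags in \<open>N\<close> the gauge
  keeps the intervals inside an open superset of \<open>N\<close> of small measure, so that absolute continuity
  bounds the increments of \<open>F\<close> over them.\<close>

lemma abs_cont_has_integral:
  assumes ac: "abs_cont_on_interval a b F" and N: "negligible N"
    and der: "\<And>x. x \<in> {a..b} - N \<Longrightarrow> (F has_real_derivative f x) (at x)" and "a \<le> b"
  shows "(f has_integral (F b - F a)) {a..b}"
proof -
  \<comment> \<open>With \<open>g = 0\<close> on \<open>N\<close>, tags in \<open>N\<close>
    contribute only increments of \<open>F\<close>; the spike at the end restores
    \<open>f\<close>.\<close>
  define g where "g x = (if x \<in> N then 0 else f x)" for x
  have "(g has_integral (F b - F a)) {a..b}"
    unfolding has_integral_real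
  proof (intro allI impI)
    fix e :: real assume "e > 0"
    \<comment> \<open>Half of \<open>e\<close> is spread over the total length \<open>b - a\<close>;
      the \<open>+ 1\<close> keeps the quotient defined for \<open>a = b\<close> and the bound
      strict.\<close>
    define e1 where "e1 = e / (2 * (b - a + 1))"
    have e1: "e1 > 0" "e1 * (b - a) < e / 2"
      using \<open>e > 0\<close> \<open>a \<le> b\<close> by (auto simp: e1_def field_simps)
    obtain \<delta> where \<delta>: "\<delta> > 0" "\<And>D. D division_of \<Union>D \<Longrightarrow> \<Union>D \<subseteq> {a..b} \<Longrightarrow>
        (\<Sum>K\<in>D. Sup K - Inf K) < \<delta> \<Longrightarrow> (\<Sum>K\<in>D. \<bar>F (Sup K) - F (Inf K)\<bar>) < e / 2"
      using ac \<open>e > 0\<close> unfolding abs_cont_on_interval_def by (meson half_gt_zero)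
    obtain T where T: "open T" "N \<subseteq> T" "T \<in> lmeasurable" "measure lebesgue T < \<delta>"
    proof -
      have N0: "N \<in> null_sets lebesgue" using N by (simp add: negligible_iff_null_sets)
      then obtain T where T: "open T" "N \<subseteq> T" "T - N \<in> lmeasurable"
          "emeasure lebesgue (T - N) < ennreal \<delta>"
        using sets_lebesgue_outer_open[of N \<delta>] \<delta>(1) by auto
      have "T \<in> lmeasurable"
        using T N0 by (metis borel_open measurable_Diff_null_set sets_completionI_sets sets_lborel)
      moreover have "measure lebesgue T = measure lebesgue (T - N)"
        by (simp add: N0 \<open>T \<in> lmeasurable\<close> fmeasurableD measure_Diff_null_set)
      moreover have "measure lebesgue (T - N) < \<delta>"
        using T by (metis emeasure_eq_measure2 ennreal_leI linorder_not_le)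
      ultimately show thesis using T that by metis
    qed
    have "\<exists>d>0. x \<in> {a..b} - N \<longrightarrow> (\<forall>y. \<bar>y - x\<bar> < d \<longrightarrow> \<bar>F y - F x - f x * (y - x)\<bar> \<le> e1 * \<bar>y - x\<bar>)" for x
    proof (cases "x \<in> {a..b} - N")
      case True
      then have "(F has_derivative (\<lambda>h. f x * h)) (at x)"
        using der has_field_derivative_def by blast
      then show ?thesis
        using e1(1) unfolding has_derivative_at_alt by (auto simp: mult.commute)
    qed (use zero_less_one in blast)
    then obtain d where d: "\<And>x. d x > 0" "\<And>x y. x \<in> {a..b} - N \<Longrightarrow> \<bar>y - x\<bar> < d x \<Longrightarrow>
        \<bar>F y - F x - f x * (y - x)\<bar> \<le> e1 * \<bar>y - x\<bar>" by metis
    define \<gamma> where "\<gamma> x = (if x \<in> N then T else ball x (d x))" for x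
    show "\<exists>\<gamma>. gauge \<gamma> \<and> (\<forall>\<D>. \<D> tagged_division_of {a..b} \<and> \<gamma> fine \<D> \<longrightarrow>
        norm ((\<Sum>(x,k)\<in>\<D>. measure lborel k *\<^sub>R g x) - (F b - F a)) < e)"
    proof (intro exI[of _ \<gamma>] conjI allI impI)
      show "gauge \<gamma>" using T d(1) by (auto simp: gauge_def \<gamma>_def)
      fix p assume p: "p tagged_division_of {a..b} \<and> \<gamma> fine p"
      then have td: "p tagged_division_of {a..b}" and fine: "\<gamma> fine p" by auto
      note tdD = tagged_division_ofD[OF td]
      define q where "q = {(x,K) \<in> p. x \<in> N}"
      have "q \<subseteq> p" by (auto simp: q_def)
      then have tq: "q tagged_partial_division_of {a..b}"
        using td tagged_division_of tagged_partial_division_subset by (metis tagged_division_of_def)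
      then have tq': "q tagged_division_of \<Union>(snd ` q)" by (rule tagged_partial_division_of_Union_self)
      have dq: "snd ` q division_of \<Union>(snd ` q)" using tq by (rule partial_division_of_tagged_division)
      have SI: "Sup K - Inf K = measure lebesgue K" if "K \<in> snd ` q" for K
      proof -
        obtain u v where "K = cbox u v" "K \<noteq> {}" using division_ofD(3,4)[OF dq \<open>K \<in> snd ` q\<close>] by metis
        then show ?thesis by (auto simp: content_real)
      qed
      have "(\<Sum>K\<in>snd ` q. Sup K - Inf K) = (\<Sum>K\<in>snd ` q. measure lebesgue K)"
        by (rule sum.cong[OF refl SI])
      also have "\<dots> = measure lebesgue (\<Union>(snd ` q))"
        using content_division[OF dq] by simp
      also have "\<dots> \<le> measure lebesgue T"
      proof (rule measure_mono_fmeasurable)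
        show "\<Union>(snd ` q) \<subseteq> T" using fine by (fastforce simp: q_def fine_def \<gamma>_def)
        show "\<Union>(snd ` q) \<in> sets lebesgue" using dq lmeasurable_division by (meson fmeasurableD)
      qed (use T in auto)
      finally have "(\<Sum>K\<in>snd ` q. Sup K - Inf K) < \<delta>" using T by linarith
      moreover have "\<Union>(snd ` q) \<subseteq> {a..b}" using tq tagged_partial_division_ofD(3)[OF tq] by fastforce
      ultimately have "(\<Sum>K\<in>snd ` q. \<bar>F (Sup K) - F (Inf K)\<bar>) < e / 2"
        using \<delta>(2) dq by blast
      moreover have "(\<Sum>(x,K)\<in>q. \<bar>F (Sup K) - F (Inf K)\<bar>) = (\<Sum>K\<in>snd ` q. \<bar>F (Sup K) - F (Inf K)\<bar>)"
      proof -
        \<comment> \<open>The passage from tagged pairs to intervals needs a summand that vanishes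
          on intervals without interior. On the empty one \<open>Sup\<close> and \<open>Inf\<close>
          are arbitrary, hence the default 0.\<close>
        define d where "d K = (if K = {} then 0 else \<bar>F (Sup K) - F (Inf K)\<bar>)" for K
        have ne: "K \<noteq> {}" if "K \<in> snd ` q" for K using division_ofD(3)[OF dq that] .
        have "(\<Sum>(x,K)\<in>q. d K) = (\<Sum>K\<in>snd ` q. d K)"
        proof (rule sum.over_tagged_division_lemma[OF tq'])
          fix u v :: real assume "box u v = {}"
          then show "d (cbox u v) = 0" by (cases "u = v") (auto simp: d_def)
        qed
        moreover have "(\<Sum>(x,K)\<in>q. d K) = (\<Sum>(x,K)\<in>q. \<bar>F (Sup K) - F (Inf K)\<bar>)"
          using ne by (intro sum.cong) (force simp: d_def)+
        moreover have "(\<Sum>K\<in>snd ` q. d K) = (\<Sum>K\<in>snd ` q. \<bar>F (Sup K) - F (Inf K)\<bar>)"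
          using ne by (intro sum.cong) (simp_all add: d_def)
        ultimately show ?thesis by simp
      qed
      ultimately have Nb: "(\<Sum>(x,K)\<in>q. \<bar>F (Sup K) - F (Inf K)\<bar>) < e / 2" by simp
      have fin: "finite p" "finite q" using tdD(1) \<open>q \<subseteq> p\<close> finite_subset by auto
      have "(\<Sum>(x,k)\<in>p. measure lborel k *\<^sub>R g x) - (F b - F a)
          = (\<Sum>(x,K)\<in>p. measure lborel K * g x - (F (Sup K) - F (Inf K)))"
        unfolding additive_tagged_division_1[OF \<open>a \<le> b\<close> td, of F, symmetric] sum_subtractf[symmetric]
        by (rule sum.cong) auto
      also have "\<bar>\<dots>\<bar> \<le> (\<Sum>(x,K)\<in>p. \<bar>measure lborel K * g x - (F (Sup K) - F (Inf K))\<bar>)"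
        by (rule order_trans[OF sum_abs]) (auto simp: case_prod_unfold)
      also have "\<dots> \<le> (\<Sum>(x,K)\<in>p. (if (x,K) \<in> q then \<bar>F (Sup K) - F (Inf K)\<bar> else 0) + e1 * measure lborel K)"
      proof (rule sum_mono, clarify)
        fix x K assume xK: "(x,K) \<in> p"
        obtain u v where K: "K = {u..v}" using tdD(4)[OF xK] by auto
        have xin: "x \<in> K" "K \<subseteq> {a..b}" using tdD(2,3)[OF xK] by auto
        then have uv: "u \<le> x" "x \<le> v" using K by auto
        show "\<bar>measure lborel K * g x - (F (Sup K) - F (Inf K))\<bar>
           \<le> (if (x,K) \<in> q then \<bar>F (Sup K) - F (Inf K)\<bar> else 0) + e1 * measure lborel K"
        proof (cases "x \<in> N")
          case True
          have "0 \<le> e1 * measure lborel K" using e1 by simp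
          with True show ?thesis using xK by (auto simp: q_def g_def abs_minus_commute)
        next
          case False
          have "K \<subseteq> ball x (d x)" using fineD[OF fine xK] False by (simp add: \<gamma>_def)
          moreover have "u \<in> K" "v \<in> K" using K uv by auto
          ultimately have "u \<in> ball x (d x)" "v \<in> ball x (d x)" by blast+
          then have "\<bar>F v - F x - f x * (v - x)\<bar> \<le> e1 * (v - x)" "\<bar>F u - F x - f x * (u - x)\<bar> \<le> e1 * (x - u)"
            using d(2)[of x v] d(2)[of x u] xin uv False by (auto simp: dist_real_def abs_minus_commute)
          then have "\<bar>(v - u) * f x - (F v - F u)\<bar> \<le> e1 * (v - u)"
            by (simp add: algebra_simps abs_le_iff)
          then show ?thesis using False uv K by (auto simp: q_def g_def)
        qed
      qed
      also have "\<dots> = (\<Sum>(x,K)\<in>p. if (x,K) \<in> q then \<bar>F (Sup K) - F (Inf K)\<bar> else 0) + e1 * (\<Sum>(x,K)\<in>p. measure lborel K)"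
        by (simp add: sum.distrib case_prod_unfold sum_distrib_left)
      also have "(\<Sum>(x,K)\<in>p. if (x,K) \<in> q then \<bar>F (Sup K) - F (Inf K)\<bar> else 0) = (\<Sum>(x,K)\<in>q. \<bar>F (Sup K) - F (Inf K)\<bar>)"
        using fin \<open>q \<subseteq> p\<close> by (intro sum.mono_neutral_cong_right) auto
      also have "(\<Sum>(x,K)\<in>p. measure lborel K) = b - a"
        using additive_content_tagged_division[of p a b] td \<open>a \<le> b\<close> by simp
      also have "(\<Sum>(x,K)\<in>q. \<bar>F (Sup K) - F (Inf K)\<bar>) + e1 * (b - a) < e" using Nb e1 by linarith
      finally show "norm ((\<Sum>(x,k)\<in>p. measure lborel k *\<^sub>R g x) - (F b - F a)) < e" by simp
    qed
  qed
  then show ?thesis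
    by (rule has_integral_spike[OF N, rotated]) (auto simp: g_def)
qed

lemma ac_primitive_has_integral:
  assumes "ac_primitive F f" "a \<le> b"
  shows "(f has_integral (F b - F a)) {a..b}"
proof -
  obtain N where "{x. \<not> (F has_real_derivative f x) (at x)} \<subseteq> N" "N \<in> null_sets lebesgue"
    using assms(1) unfolding ac_primitive_def eventually_ae_filter by auto
  then show ?thesis
    using assms by (intro abs_cont_has_integral[of _ _ _ N])
      (auto simp: ac_primitive_def locally_abs_cont_def negligible_iff_null_sets)
qed

section \<open>Closure properties of absolute continuity\<close>

lemma division_of_pair:
  fixes s t :: real assumes "s \<le> t"
  shows "{{s..t}} division_of \<Union>{{s..t}}"
  using assms division_of_self[of s t] by simp

lemma abs_cont_uniform:
  assumes "abs_cont_on_interval a b F" "e > 0"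
  obtains d where "d > 0" "\<And>s t. s \<in> {a..b} \<Longrightarrow> t \<in> {a..b} \<Longrightarrow> \<bar>s - t\<bar> < d \<Longrightarrow> \<bar>F s - F t\<bar> < e"
proof -
  obtain d where d: "d > 0" "\<And>D. D division_of \<Union>D \<Longrightarrow> \<Union>D \<subseteq> {a..b} \<Longrightarrow>
        (\<Sum>K\<in>D. Sup K - Inf K) < d \<Longrightarrow> (\<Sum>K\<in>D. \<bar>F (Sup K) - F (Inf K)\<bar>) < e"
    using assms unfolding abs_cont_on_interval_def by meson
  have *: "\<bar>F t - F s\<bar> < e" if "a \<le> s" "s \<le> t" "t \<le> b" "t - s < d" for s t
    using d(2)[OF division_of_pair[OF that(2)]] that by auto
  show thesis
  proof (rule that[OF d(1)])
    fix s t assume "s \<in> {a..b}" "t \<in> {a..b}" "\<bar>s - t\<bar> < d"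
    then show "\<bar>F s - F t\<bar> < e"
      using *[of s t] *[of t s] by (cases "s \<le> t") (auto simp: abs_minus_commute)
  qed
qed

lemma locally_abs_cont_continuous:
  assumes "locally_abs_cont F"
  shows "continuous_on S F"
proof -
  have "isCont F x" for x
    unfolding continuous_at_eps_delta
  proof (intro allI impI)
    fix e :: real assume "e > 0"
    then obtain d where d: "d > 0" "\<And>s t. s \<in> {x-1..x+1} \<Longrightarrow> t \<in> {x-1..x+1} \<Longrightarrow> \<bar>s - t\<bar> < d \<Longrightarrow> \<bar>F s - F t\<bar> < e"
      using assms abs_cont_uniform unfolding locally_abs_cont_def by metis
    show "\<exists>d>0. \<forall>x'. dist x' x < d \<longrightarrow> dist (F x') (F x) < e"
      by (rule exI[of _ "min d 1"]) (use d(1) in \<open>auto simp: dist_real_def intro!: d(2)\<close>)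
  qed
  then show ?thesis by (simp add: continuous_at_imp_continuous_on)
qed

text \<open>One domination principle behind all closure properties: products, differences, added
  constants and C1 composition only have to bound their increments by those of \<open>F\<close> and
  \<open>G\<close>.\<close>

lemma abs_cont_on_interval_lipschitz2:
  assumes "abs_cont_on_interval a b F" "abs_cont_on_interval a b G" "L \<ge> 0"
    and L: "\<And>s t. s \<in> {a..b} \<Longrightarrow> t \<in> {a..b} \<Longrightarrow> \<bar>H s - H t\<bar> \<le> L * (\<bar>F s - F t\<bar> + \<bar>G s - G t\<bar>)"
  shows "abs_cont_on_interval a b H"
  unfolding abs_cont_on_interval_def
proof (intro allI impI)
  fix e :: real assume "e > 0"
  define e' where "e' = e / (2 * (L + 1))"
  have e': "e' > 0" "L * (e' + e') < e"
  proof -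
    show "e' > 0" using \<open>e > 0\<close> \<open>L \<ge> 0\<close> by (simp add: e'_def)
    have "(L + 1) * (2 * e') = e" using \<open>L \<ge> 0\<close> by (simp add: e'_def field_simps)
    then show "L * (e' + e') < e" using \<open>e' > 0\<close> by (simp add: algebra_simps)
  qed
  obtain d1 where d1: "d1 > 0" "\<And>D. D division_of \<Union>D \<and> \<Union>D \<subseteq> {a..b} \<and> (\<Sum>K\<in>D. Sup K - Inf K) < d1
        \<Longrightarrow> (\<Sum>K\<in>D. \<bar>F (Sup K) - F (Inf K)\<bar>) < e'"
    using assms(1) e' unfolding abs_cont_on_interval_def by meson
  obtain d2 where d2: "d2 > 0" "\<And>D. D division_of \<Union>D \<and> \<Union>D \<subseteq> {a..b} \<and> (\<Sum>K\<in>D. Sup K - Inf K) < d2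
        \<Longrightarrow> (\<Sum>K\<in>D. \<bar>G (Sup K) - G (Inf K)\<bar>) < e'"
    using assms(2) e' unfolding abs_cont_on_interval_def by meson
  show "\<exists>\<delta>>0. \<forall>D. D division_of \<Union>D \<and> \<Union>D \<subseteq> {a..b} \<and> (\<Sum>K\<in>D. Sup K - Inf K) < \<delta>
        \<longrightarrow> (\<Sum>K\<in>D. \<bar>H (Sup K) - H (Inf K)\<bar>) < e"
  proof (intro exI[of _ "min d1 d2"] conjI allI impI)
    show "min d1 d2 > 0" using d1 d2 by simp
    fix D assume D: "D division_of \<Union>D \<and> \<Union>D \<subseteq> {a..b} \<and> (\<Sum>K\<in>D. Sup K - Inf K) < min d1 d2"
    have "(\<Sum>K\<in>D. \<bar>H (Sup K) - H (Inf K)\<bar>)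
       \<le> (\<Sum>K\<in>D. L * (\<bar>F (Sup K) - F (Inf K)\<bar> + \<bar>G (Sup K) - G (Inf K)\<bar>))"
    proof (rule sum_mono)
      fix K assume "K \<in> D"
      have dD: "D division_of \<Union>D" and KD: "K \<subseteq> {a..b}" using D \<open>K \<in> D\<close> by auto
      obtain u v where "K = {u..v}" "u \<le> v"
        using division_ofD(3,4)[OF dD \<open>K \<in> D\<close>] by (metis atLeastatMost_empty_iff2 box_real(2))
      with KD show "\<bar>H (Sup K) - H (Inf K)\<bar> \<le> L * (\<bar>F (Sup K) - F (Inf K)\<bar> + \<bar>G (Sup K) - G (Inf K)\<bar>)"
        using L by auto
    qed
    also have "\<dots> = L * ((\<Sum>K\<in>D. \<bar>F (Sup K) - F (Inf K)\<bar>) + (\<Sum>K\<in>D. \<bar>G (Sup K) - G (Inf K)\<bar>))"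
      unfolding sum.distrib[symmetric] sum_distrib_left ..
    also have "\<dots> \<le> L * (e' + e')"
      using d1(2)[of D] d2(2)[of D] D \<open>L \<ge> 0\<close> by (intro mult_left_mono) auto
    finally show "(\<Sum>K\<in>D. \<bar>H (Sup K) - H (Inf K)\<bar>) < e" using e' by simp
  qed
qed

lemma abs_cont_on_interval_ident: "abs_cont_on_interval a b (\<lambda>x. x)"
  unfolding abs_cont_on_interval_def
proof (intro allI impI)
  fix e :: real assume "e > 0"
  have "(\<Sum>K\<in>D. \<bar>Sup K - Inf K\<bar>) = (\<Sum>K\<in>D. Sup K - Inf K)" if D: "D division_of \<Union>D" for D :: "real set set"
  proof (rule sum.cong)
    fix K assume "K \<in> D"
    obtain u v where "K = {u..v}" "u \<le> v"
      using division_ofD(3,4)[OF D \<open>K \<in> D\<close>] by (metis atLeastatMost_empty_iff2 box_real(2))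
    then show "\<bar>Sup K - Inf K\<bar> = Sup K - Inf K" by auto
  qed simp
  then show "\<exists>\<delta>>0. \<forall>D. D division_of \<Union>D \<and> \<Union>D \<subseteq> {a..b} \<and> (\<Sum>K\<in>D. Sup K - Inf K) < \<delta>
        \<longrightarrow> (\<Sum>K\<in>D. \<bar>Sup K - Inf K\<bar>) < e"
    using \<open>e > 0\<close> by auto
qed

lemma continuous_on_interval_bounded:
  fixes F :: "real \<Rightarrow> real"
  assumes "continuous_on {a..b} F"
  obtains M where "M \<ge> 0" "\<And>x. x \<in> {a..b} \<Longrightarrow> \<bar>F x\<bar> \<le> M"
proof -
  have "compact (F ` {a..b})" using assms compact_continuous_image compact_Icc by blast
  then obtain M where "\<forall>y\<in>F ` {a..b}. norm y \<le> M" "M > 0"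
    using bounded_pos compact_imp_bounded by blast
  then show thesis using that[of M] by auto
qed

lemma locally_abs_cont_mult:
  assumes "locally_abs_cont F" "locally_abs_cont G"
  shows "locally_abs_cont (\<lambda>x. F x * G x)"
  unfolding locally_abs_cont_def
proof (intro allI)
  fix a b
  obtain M where M: "M \<ge> 0" "\<And>x. x \<in> {a..b} \<Longrightarrow> \<bar>F x\<bar> \<le> M"
    using continuous_on_interval_bounded locally_abs_cont_continuous assms(1) by metis
  obtain N where N: "N \<ge> 0" "\<And>x. x \<in> {a..b} \<Longrightarrow> \<bar>G x\<bar> \<le> N"
    using continuous_on_interval_bounded locally_abs_cont_continuous assms(2) by metis
  show "abs_cont_on_interval a b (\<lambda>x. F x * G x)"
  proof (rule abs_cont_on_interval_lipschitz2[where F = F and G = G and L = "M + N"])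
    fix s t assume st: "s \<in> {a..b}" "t \<in> {a..b}"
    have "F s * G s - F t * G t = F s * (G s - G t) + (F s - F t) * G t" by (simp add: algebra_simps)
    also have "\<bar>\<dots>\<bar> \<le> \<bar>F s\<bar> * \<bar>G s - G t\<bar> + \<bar>F s - F t\<bar> * \<bar>G t\<bar>"
      by (metis abs_mult abs_triangle_ineq)
    also have "\<dots> \<le> M * \<bar>G s - G t\<bar> + \<bar>F s - F t\<bar> * N"
      using M N st by (intro add_mono mult_mono) auto
    also have "\<dots> \<le> (M + N) * (\<bar>F s - F t\<bar> + \<bar>G s - G t\<bar>)"
      using M(1) N(1) by (simp add: algebra_simps)
    finally show "\<bar>F s * G s - F t * G t\<bar> \<le> (M + N) * (\<bar>F s - F t\<bar> + \<bar>G s - G t\<bar>)" .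
  qed (use assms M N in \<open>auto simp: locally_abs_cont_def\<close>)
qed

lemma locally_abs_cont_diff:
  assumes "locally_abs_cont F" "locally_abs_cont G"
  shows "locally_abs_cont (\<lambda>x. F x - G x)"
  unfolding locally_abs_cont_def
proof (intro allI)
  fix a b
  show "abs_cont_on_interval a b (\<lambda>x. F x - G x)"
    by (rule abs_cont_on_interval_lipschitz2[where F = F and G = G and L = 1])
      (use assms in \<open>auto simp: locally_abs_cont_def\<close>)
qed

lemma locally_abs_cont_shift:
  assumes "locally_abs_cont F"
  shows "locally_abs_cont (\<lambda>x. c + F x)"
  unfolding locally_abs_cont_def
proof (intro allI)
  fix a b
  show "abs_cont_on_interval a b (\<lambda>x. c + F x)"
    by (rule abs_cont_on_interval_lipschitz2[where F = F and G = F and L = 1])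
      (use assms in \<open>auto simp: locally_abs_cont_def\<close>)
qed

text \<open>On a compact interval \<open>F\<close> takes values in some \<open>{-M..M}\<close>,
  where \<open>g'\<close> is bounded and \<open>g\<close> therefore Lipschitz.\<close>

lemma locally_abs_cont_compose_C1:
  assumes F: "locally_abs_cont F" and der: "\<And>y. (g has_real_derivative g' y) (at y)"
    and g': "continuous_on UNIV g'"
  shows "locally_abs_cont (\<lambda>x. g (F x))"
  unfolding locally_abs_cont_def
proof (intro allI)
  fix a b
  obtain M where M: "M \<ge> 0" "\<And>x. x \<in> {a..b} \<Longrightarrow> \<bar>F x\<bar> \<le> M"
    using continuous_on_interval_bounded locally_abs_cont_continuous F by metis
  obtain L where L: "L \<ge> 0" "\<And>y. y \<in> {-M..M} \<Longrightarrow> \<bar>g' y\<bar> \<le> L"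
    using continuous_on_interval_bounded continuous_on_subset[OF g' subset_UNIV] by metis
  show "abs_cont_on_interval a b (\<lambda>x. g (F x))"
  proof (rule abs_cont_on_interval_lipschitz2[where F = F and G = F and L = L])
    fix s t assume "s \<in> {a..b}" "t \<in> {a..b}"
    then have "F s \<in> {-M..M}" "F t \<in> {-M..M}" using M(2)[of s] M(2)[of t] by auto
    then have "norm (g (F s) - g (F t)) \<le> L * norm (F s - F t)"
      using der L by (intro field_differentiable_bound[of "{-M..M}" g g'])
        (auto intro: has_field_derivative_at_within)
    also have "\<dots> \<le> L * (\<bar>F s - F t\<bar> + \<bar>F s - F t\<bar>)" using L(1) by (intro mult_left_mono) auto
    finally show "\<bar>g (F s) - g (F t)\<bar> \<le> L * (\<bar>F s - F t\<bar> + \<bar>F s - F t\<bar>)" by simp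
  qed (use F L in \<open>auto simp: locally_abs_cont_def\<close>)
qed

lemma locally_abs_cont_C1:
  assumes "\<And>y. (g has_real_derivative g' y) (at y)" "continuous_on UNIV g'"
  shows "locally_abs_cont g"
  using locally_abs_cont_compose_C1[OF _ assms, of "\<lambda>x. x"] abs_cont_on_interval_ident
  by (simp add: locally_abs_cont_def)

section \<open>Product and chain rules for primitives\<close>

lemma ac_primitive_C1:
  assumes "\<And>y. (g has_real_derivative g' y) (at y)" "continuous_on UNIV g'"
  shows "ac_primitive g g'"
  using assms locally_abs_cont_C1 by (auto simp: ac_primitive_def)

lemma ac_primitive_mult:
  assumes "ac_primitive F f" "ac_primitive G g"
  shows "ac_primitive (\<lambda>x. F x * G x) (\<lambda>x. f x * G x + F x * g x)"
  unfolding ac_primitive_def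
proof
  have "AE x in lebesgue. (F has_real_derivative f x) (at x) \<and> (G has_real_derivative g x) (at x)"
    using assms by (auto simp: ac_primitive_def)
  then show "AE x in lebesgue. ((\<lambda>x. F x * G x) has_real_derivative f x * G x + F x * g x) (at x)"
    by (rule eventually_mono) (auto intro!: derivative_eq_intros)
qed (use assms in \<open>auto simp: ac_primitive_def intro: locally_abs_cont_mult\<close>)

lemma ac_primitive_diff:
  assumes "ac_primitive F f" "ac_primitive G g"
  shows "ac_primitive (\<lambda>x. F x - G x) (\<lambda>x. f x - g x)"
  unfolding ac_primitive_def
proof
  have "AE x in lebesgue. (F has_real_derivative f x) (at x) \<and> (G has_real_derivative g x) (at x)"
    using assms by (auto simp: ac_primitive_def)
  then show "AE x in lebesgue. ((\<lambda>x. F x - G x) has_real_derivative f x - g x) (at x)"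
    by (rule eventually_mono) (auto intro!: derivative_eq_intros)
qed (use assms in \<open>auto simp: ac_primitive_def intro: locally_abs_cont_diff\<close>)

lemma ac_primitive_shift:
  assumes "ac_primitive F f"
  shows "ac_primitive (\<lambda>x. c + F x) f"
  unfolding ac_primitive_def
proof
  show "AE x in lebesgue. ((\<lambda>x. c + F x) has_real_derivative f x) (at x)"
    using assms by (auto simp: ac_primitive_def elim!: eventually_mono intro!: derivative_eq_intros)
qed (use assms in \<open>auto simp: ac_primitive_def intro: locally_abs_cont_shift\<close>)

lemma ac_primitive_compose_C1:
  assumes "ac_primitive F f" "\<And>y. (g has_real_derivative g' y) (at y)" "continuous_on UNIV g'"
  shows "ac_primitive (\<lambda>x. g (F x)) (\<lambda>x. g' (F x) * f x)"
proof -
  have "AE x in lebesgue. ((\<lambda>x. g (F x)) has_real_derivative g' (F x) * f x) (at x)"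
    using assms(1) unfolding ac_primitive_def
    by (auto elim!: eventually_mono intro: DERIV_chain2[OF assms(2)])
  then show ?thesis
    using assms locally_abs_cont_compose_C1 by (auto simp: ac_primitive_def)
qed

section \<open>Indefinite integrals of locally integrable functions\<close>

text \<open>Absolute integrability, unlike mere gauge integrability, survives multiplication by a
  continuous function and allows truncation.\<close>

definition loc_integrable :: "(real \<Rightarrow> real) \<Rightarrow> bool" where
  "loc_integrable f \<longleftrightarrow> (\<forall>a b. f absolutely_integrable_on {a..b})"

text \<open>The oriented integral from 0 to \<open>x\<close>: at least one of the two intervals is
  empty or a point.\<close>

definition indef_integral :: "(real \<Rightarrow> real) \<Rightarrow> real \<Rightarrow> real" where
  "indef_integral f x = integral {0..x} f - integral {x..0} f"

lemma loc_integrable_continuous: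
  assumes "continuous_on UNIV f"
  shows "loc_integrable f"
  using assms continuous_on_subset unfolding loc_integrable_def
  by (blast intro: absolutely_integrable_continuous_real)

lemma loc_integrable_add:
  assumes "loc_integrable f" "loc_integrable g"
  shows "loc_integrable (\<lambda>x. f x + g x)"
  using assms unfolding loc_integrable_def by (blast intro: set_integral_add)

lemma loc_integrable_diff:
  assumes "loc_integrable f" "loc_integrable g"
  shows "loc_integrable (\<lambda>x. f x - g x)"
  using assms unfolding loc_integrable_def by (blast intro: set_integral_diff)

lemma loc_integrable_abs:
  assumes "loc_integrable f"
  shows "loc_integrable (\<lambda>x. \<bar>f x\<bar>)"
  using assms absolutely_integrable_norm unfolding loc_integrable_def by (fastforce simp: o_def)

lemma loc_integrable_mult_continuous:
  assumes "loc_integrable f" and g: "continuous_on UNIV g"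
  shows "loc_integrable (\<lambda>x. f x * g x)"
  unfolding loc_integrable_def
proof (intro allI)
  fix a b :: real
  have g': "continuous_on {a..b} g" using g continuous_on_subset by blast
  have "(\<lambda>x. g x * f x) absolutely_integrable_on {a..b}"
  proof (rule absolutely_integrable_bounded_measurable_product_real)
    show "g \<in> borel_measurable (lebesgue_on {a..b})"
      using g' by (intro continuous_imp_measurable_on_sets_lebesgue) auto
    show "bounded (g ` {a..b})"
      using g' compact_continuous_image compact_imp_bounded by blast
  qed (use assms in \<open>auto simp: loc_integrable_def\<close>)
  then show "(\<lambda>x. f x * g x) absolutely_integrable_on {a..b}"
    by (simp add: mult.commute)
qed

lemma loc_integrable_integrable_on: "loc_integrable f \<Longrightarrow> f integrable_on {a..b}"
  unfolding loc_integrable_def by (blast intro: set_lebesgue_integral_eq_integral(1))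

lemma indef_integral_0 [simp]: "indef_integral f 0 = 0"
  by (simp add: indef_integral_def)

lemma indef_integral_has_integral:
  assumes f: "loc_integrable f" and "a \<le> b"
  shows "(f has_integral (indef_integral f b - indef_integral f a)) {a..b}"
proof -
  note int = loc_integrable_integrable_on[OF f]
  \<comment> \<open>A base point \<open>c\<close> left of 0 and of \<open>x\<close> replaces
    oriented integrals by ordinary ones, so the signs of \<open>a\<close> and \<open>b\<close> no
    longer matter.\<close>
  have eq: "indef_integral f x = integral {c..x} f - integral {c..0} f" if "c \<le> x" "c \<le> 0" for c x
  proof (cases "x \<ge> 0")
    case True
    then have "integral {c..0} f + integral {0..x} f = integral {c..x} f"
      using that by (intro Henstock_Kurzweil_Integration.integral_combine int) auto
    then show ?thesis using True by (cases "x = 0") (auto simp: indef_integral_def)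
  next
    case False
    then have "integral {c..x} f + integral {x..0} f = integral {c..0} f"
      using that by (intro Henstock_Kurzweil_Integration.integral_combine int) auto
    then show ?thesis using False by (auto simp: indef_integral_def)
  qed
  have "integral {min a 0..a} f + integral {a..b} f = integral {min a 0..b} f"
    using \<open>a \<le> b\<close> by (intro Henstock_Kurzweil_Integration.integral_combine int) auto
  then have "indef_integral f b - indef_integral f a = integral {a..b} f"
    using eq[of "min a 0" a] eq[of "min a 0" b] \<open>a \<le> b\<close> by linarith
  then show ?thesis using int[of a b] by (simp add: has_integral_integral)
qed

text \<open>The integrand is the excess of \<open>\<bar>f x\<bar>\<close> over the level
  \<open>n\<close>; it is dominated by \<open>\<bar>f x\<bar>\<close> and eventually 0 at each
  point. This splits \<open>f\<close> into a bounded part and a part of small integral.\<close>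

lemma integral_truncation_tendsto:
  fixes f :: "real \<Rightarrow> real"
  assumes "f absolutely_integrable_on {a..b}"
  shows "(\<lambda>n. integral {a..b} (\<lambda>x. \<bar>f x\<bar> - min \<bar>f x\<bar> (real n))) \<longlonglongrightarrow> 0"
    and "(\<lambda>x. \<bar>f x\<bar> - min \<bar>f x\<bar> (real n)) absolutely_integrable_on {a..b}"
proof -
  have abs: "(\<lambda>x. \<bar>f x\<bar>) absolutely_integrable_on {a..b}"
    using absolutely_integrable_norm[OF assms] by (simp add: o_def)
  have "(\<lambda>x. min \<bar>f x\<bar> (real n)) absolutely_integrable_on {a..b}" for n
    using absolutely_integrable_min[OF abs, of "\<lambda>_. real n"] by (simp add: absolutely_integrable_on_const)
  then show *: "(\<lambda>x. \<bar>f x\<bar> - min \<bar>f x\<bar> (real n)) absolutely_integrable_on {a..b}" for n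
    using abs by (intro set_integral_diff) auto
  have "(\<lambda>n. integral {a..b} (\<lambda>x. \<bar>f x\<bar> - min \<bar>f x\<bar> (real n))) \<longlonglongrightarrow> integral {a..b} (\<lambda>x. 0)"
  proof (rule dominated_convergence(2))
    show "(\<lambda>x. \<bar>f x\<bar> - min \<bar>f x\<bar> (real n)) integrable_on {a..b}" for n
      using * set_lebesgue_integral_eq_integral(1) by blast
    show "(\<lambda>x. \<bar>f x\<bar>) integrable_on {a..b}"
      using abs set_lebesgue_integral_eq_integral(1) by blast
    show "(\<lambda>n. \<bar>f x\<bar> - min \<bar>f x\<bar> (real n)) \<longlonglongrightarrow> 0" for x
    proof (rule tendsto_eventually)
      obtain N where N: "\<bar>f x\<bar> \<le> real N" using real_arch_simple by blast
      show "\<forall>\<^sub>F n in sequentially. \<bar>f x\<bar> - min \<bar>f x\<bar> (real n) = 0"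
        using eventually_ge_at_top[of N] by eventually_elim (use N in auto)
    qed
  qed auto
  then show "(\<lambda>n. integral {a..b} (\<lambda>x. \<bar>f x\<bar> - min \<bar>f x\<bar> (real n))) \<longlonglongrightarrow> 0" by simp
qed

text \<open>By truncation \<open>\<bar>f x\<bar> \<le> g n x + n\<close>. The excess
  \<open>g n\<close> integrates to less than \<open>e / 2\<close> over any family of intervals, and
  the level \<open>n\<close> costs \<open>n\<close> times their total length.\<close>

lemma locally_abs_cont_indef_integral:
  assumes f: "loc_integrable f"
  shows "locally_abs_cont (indef_integral f)"
  unfolding locally_abs_cont_def abs_cont_on_interval_def
proof (intro allI impI)
  fix a b e :: real assume "e > 0"
  have fab: "f absolutely_integrable_on {a..b}" using f by (simp add: loc_integrable_def)
  define g where "g n x = \<bar>f x\<bar> - min \<bar>f x\<bar> (real n)" for n :: nat and x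
  have "(\<lambda>n. integral {a..b} (g n)) \<longlonglongrightarrow> 0"
    using integral_truncation_tendsto(1)[OF fab] by (simp add: g_def[abs_def])
  then obtain n where "\<bar>integral {a..b} (g n)\<bar> < e / 2"
    using \<open>e > 0\<close> by (auto simp: LIMSEQ_def dist_real_def dest!: spec[of _ "e / 2"])
  then have n: "integral {a..b} (g n) < e / 2" by linarith
  have gint: "g n integrable_on {a..b}"
    using integral_truncation_tendsto(2)[OF fab] set_lebesgue_integral_eq_integral(1)
    unfolding g_def by blast
  define d where "d = e / (2 * (real n + 1))"
  have d: "d > 0" "real n * d < e / 2" using \<open>e > 0\<close> by (auto simp: d_def field_simps)
  show "\<exists>\<delta>>0. \<forall>D. D division_of \<Union>D \<and> \<Union>D \<subseteq> {a..b} \<and> (\<Sum>K\<in>D. Sup K - Inf K) < \<delta>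
        \<longrightarrow> (\<Sum>K\<in>D. \<bar>indef_integral f (Sup K) - indef_integral f (Inf K)\<bar>) < e"
  proof (intro exI[of _ d] conjI allI impI d(1))
    fix D assume D: "D division_of \<Union>D \<and> \<Union>D \<subseteq> {a..b} \<and> (\<Sum>K\<in>D. Sup K - Inf K) < d"
    then have dD: "D division_of \<Union>D" and sub: "\<Union>D \<subseteq> {a..b}" by auto
    have "(\<Sum>K\<in>D. \<bar>indef_integral f (Sup K) - indef_integral f (Inf K)\<bar>)
        \<le> (\<Sum>K\<in>D. integral K (g n) + real n * (Sup K - Inf K))"
    proof (rule sum_mono)
      fix K assume K: "K \<in> D"
      obtain u v where uv: "K = {u..v}" "u \<le> v"
        using division_ofD(3,4)[OF dD K] by (metis atLeastatMost_empty_iff2 box_real(2))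
      have "K \<subseteq> {a..b}" using K sub by blast
      then have gK: "g n integrable_on {u..v}" using gint uv integrable_on_subinterval by blast
      have "\<bar>indef_integral f v - indef_integral f u\<bar> = norm (integral {u..v} f)"
        using indef_integral_has_integral[OF f uv(2)] by (simp add: integral_unique)
      also have "\<dots> \<le> integral {u..v} (\<lambda>x. g n x + real n)"
      proof (rule Henstock_Kurzweil_Integration.integral_norm_bound_integral)
        show "(\<lambda>x. g n x + real n) integrable_on {u..v}"
          using gK by (intro integrable_add integrable_const_ivl)
      qed (use f in \<open>auto simp: loc_integrable_integrable_on g_def\<close>)
      also have "\<dots> = integral {u..v} (g n) + real n * (v - u)"
        using gK uv(2) by (subst integral_add) (auto intro: integrable_const_ivl)
      finally show "\<bar>indef_integral f (Sup K) - indef_integral f (Inf K)\<bar> \<le> integral K (g n) + real n * (Sup K - Inf K)"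
        using uv by simp
    qed
    also have "\<dots> = (\<Sum>K\<in>D. integral K (g n)) + real n * (\<Sum>K\<in>D. Sup K - Inf K)"
      by (simp add: sum.distrib sum_distrib_left)
    finally have "(\<Sum>K\<in>D. \<bar>indef_integral f (Sup K) - indef_integral f (Inf K)\<bar>)
        \<le> (\<Sum>K\<in>D. integral K (g n)) + real n * (\<Sum>K\<in>D. Sup K - Inf K)" .
    moreover have gU: "g n integrable_on \<Union>D" by (rule integrable_on_subdivision[OF dD gint sub])
    then have "(\<Sum>K\<in>D. integral K (g n)) = integral (\<Union>D) (g n)"
      using integral_combine_division_topdown[OF _ dD] by metis
    moreover have "integral (\<Union>D) (g n) \<le> integral {a..b} (g n)"
      by (rule integral_subset_le[OF sub gU gint]) (simp add: g_def)
    moreover have "real n * (\<Sum>K\<in>D. Sup K - Inf K) \<le> real n * d"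
      using D by (intro mult_left_mono) auto
    ultimately show "(\<Sum>K\<in>D. \<bar>indef_integral f (Sup K) - indef_integral f (Inf K)\<bar>) < e"
      using n d by linarith
  qed
qed

text \<open>Lebesgue differentiation over cubes with lower corner \<open>x\<close>, in dimension
  one; hence quotients from the right only.\<close>

lemma integral_right_difference_quotient:
  fixes f :: "real \<Rightarrow> real"
  assumes "\<And>a b. f integrable_on {a..b}"
  obtains N where "negligible N"
    "\<And>x e. x \<notin> N \<Longrightarrow> 0 < e \<Longrightarrow> \<exists>d>0. \<forall>h. 0 < h \<and> h < d \<longrightarrow> \<bar>integral {x..x + h} f / h - f x\<bar> < e"
proof -
  obtain N where N: "negligible N" and *: "\<And>x e. \<lbrakk>x \<notin> N; 0 < e\<rbrakk> \<Longrightarrow> \<exists>d>0. \<forall>h. 0 < h \<and> h < d \<longrightarrow>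
      norm (integral (cbox x (x + h *\<^sub>R One)) f /\<^sub>R h ^ DIM(real) - f x) < e"
    by (rule integrable_ccontinuous_explicit[of f]) (use assms in auto)
  have "norm (integral (cbox x (x + h *\<^sub>R One)) f /\<^sub>R h ^ DIM(real) - f x) = \<bar>integral {x..x + h} f / h - f x\<bar>" for x h
    by (simp add: divide_inverse_commute)
  then show thesis using that[OF N] * by presburger
qed

text \<open>Left quotients at \<open>x\<close> are right quotients of the reflected function at
  \<open>- x\<close>. So the one-sided result is used twice, and its second exceptional set is
  reflected back.\<close>

lemma AE_indef_integral_has_real_derivative:
  assumes f: "loc_integrable f"
  shows "AE x in lebesgue. (indef_integral f has_real_derivative f x) (at x)"
proof -
  note int = loc_integrable_integrable_on[OF f]
  have int': "(\<lambda>x. f (- x)) integrable_on {a..b}" for a b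
    using int[of "-b" "-a"] Henstock_Kurzweil_Integration.integrable_reflect_real[of f "-a" "-b"] by simp
  obtain N where N: "negligible N" "\<And>x e. x \<notin> N \<Longrightarrow> 0 < e \<Longrightarrow>
      \<exists>d>0. \<forall>h. 0 < h \<and> h < d \<longrightarrow> \<bar>integral {x..x + h} f / h - f x\<bar> < e"
    using integral_right_difference_quotient[of f] int by blast
  obtain N' where N': "negligible N'" "\<And>x e. x \<notin> N' \<Longrightarrow> 0 < e \<Longrightarrow>
      \<exists>d>0. \<forall>h. 0 < h \<and> h < d \<longrightarrow> \<bar>integral {x..x + h} (\<lambda>x. f (- x)) / h - f (- x)\<bar> < e"
    using integral_right_difference_quotient[of "\<lambda>x. f (- x)"] int' by blast
  define Z where "Z = N \<union> uminus ` N'"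
  have "negligible Z"
    unfolding Z_def using N N'
    by (intro negligible_Un negligible_differentiable_image_negligible)
      (auto intro!: derivative_intros)
  moreover have "(indef_integral f has_real_derivative f x) (at x)" if "x \<notin> Z" for x
  proof -
    have x: "x \<notin> N" "- x \<notin> N'" using that by (auto simp: Z_def image_iff)
    show ?thesis
      unfolding has_field_derivative_def has_derivative_at_alt
    proof (intro conjI allI impI)
      show "bounded_linear ((*) (f x))" by (rule bounded_linear_mult_right)
      fix e :: real assume "e > 0"
      obtain d1 where d1: "d1 > 0" "\<And>h. 0 < h \<Longrightarrow> h < d1 \<Longrightarrow> \<bar>integral {x..x + h} f / h - f x\<bar> < e"
        using N(2)[OF x(1) \<open>e > 0\<close>] by blast
      obtain d2 where d2: "d2 > 0" "\<And>h. 0 < h \<Longrightarrow> h < d2 \<Longrightarrow> \<bar>integral {-x..-x + h} (\<lambda>x. f (-x)) / h - f x\<bar> < e"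
        using N'(2)[OF x(2) \<open>e > 0\<close>] unfolding minus_minus by blast
      have scale: "\<bar>I - c * h\<bar> \<le> e * h" if "h > 0" "\<bar>I / h - c\<bar> < e" for I c h
      proof -
        have "\<bar>I - c * h\<bar> = \<bar>I / h - c\<bar> * h"
          using that(1) by (simp add: abs_mult_pos' field_simps)
        then show ?thesis using that by (simp add: mult_right_mono)
      qed
      show "\<exists>d>0. \<forall>y. norm (y - x) < d \<longrightarrow>
          norm (indef_integral f y - indef_integral f x - f x * (y - x)) \<le> e * norm (y - x)"
      proof (intro exI[of _ "min d1 d2"] conjI allI impI)
        fix y assume y: "norm (y - x) < min d1 d2"
        consider "y = x" | "y > x" | "y < x" by linarith
        then show "norm (indef_integral f y - indef_integral f x - f x * (y - x)) \<le> e * norm (y - x)"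
        proof cases
          case 2
          have "indef_integral f y - indef_integral f x = integral {x..x + (y - x)} f"
            using indef_integral_has_integral[OF f, of x y] 2 by (simp add: integral_unique)
          then show ?thesis using scale[OF _ d1(2)[of "y - x"]] 2 y by simp
        next
          case 3
          have "indef_integral f x - indef_integral f y = integral {y..x} f"
            using indef_integral_has_integral[OF f, of y x] 3 by (simp add: integral_unique)
          also have "\<dots> = integral {-x..-x + (x - y)} (\<lambda>x. f (-x))"
            using Henstock_Kurzweil_Integration.integral_reflect_real[of x y f] by simp
          finally have "\<bar>indef_integral f x - indef_integral f y - f x * (x - y)\<bar> \<le> e * (x - y)"
            using scale[OF _ d2(2)[of "x - y"]] 3 y by simp
          moreover have "indef_integral f y - indef_integral f x - f x * (y - x)
              = - (indef_integral f x - indef_integral f y - f x * (x - y))" by (simp add: algebra_simps)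
          ultimately show ?thesis using 3 by (simp only: real_norm_def abs_minus_cancel) simp
        qed simp
      qed (use d1 d2 in simp)
    qed
  qed
  ultimately show ?thesis
    by (intro AE_I'[of Z]) (auto simp: negligible_iff_null_sets)
qed

lemma ac_primitive_indef_integral:
  assumes "loc_integrable f"
  shows "ac_primitive (indef_integral f) f"
  using assms locally_abs_cont_indef_integral AE_indef_integral_has_real_derivative
  by (simp add: ac_primitive_def)

section \<open>Existence of solutions\<close>

text \<open>The equation u'' = q u as a first-order system, later with \<open>q = V - E\<close>. As
  \<open>v\<close> is continuous, only its own derivative has to be taken almost everywhere.\<close>

definition ode_solution :: "(real \<Rightarrow> real) \<Rightarrow> (real \<Rightarrow> real) \<Rightarrow> (real \<Rightarrow> real) \<Rightarrow> bool" where
  "ode_solution q u v \<longleftrightarrow>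
     (\<forall>x. (u has_real_derivative v x) (at x)) \<and> ac_primitive v (\<lambda>x. q x * u x)"

lemma ac_primitive_continuous: "ac_primitive F f \<Longrightarrow> continuous_on S F"
  by (simp add: ac_primitive_def locally_abs_cont_continuous)

text \<open>A solution \<open>u\<close> must be differentiable at every point, which the
  almost-everywhere result cannot give; its integrand \<open>v\<close> is continuous.\<close>

lemma indef_integral_has_real_derivative:
  assumes f: "continuous_on UNIV f"
  shows "(indef_integral f has_real_derivative f x) (at x)"
proof -
  \<comment> \<open>The base point \<open>x - 1\<close> places \<open>x\<close> in the interior, so
    the derivative within the interval is the full one.\<close>
  have "((\<lambda>y. integral {x - 1..y} f) has_real_derivative f x) (at x within {x - 1..x + 1})"
    using f continuous_on_subset by (intro integral_has_real_derivative) auto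
  then have "((\<lambda>y. integral {x - 1..y} f) has_real_derivative f x) (at x)"
    by (simp add: at_within_Icc_at)
  then have "((\<lambda>y. indef_integral f (x - 1) + integral {x - 1..y} f) has_real_derivative f x) (at x)"
    by (auto intro!: derivative_eq_intros)
  then show ?thesis
  proof (rule has_field_derivative_transform_within_open[where S = "{x - 1<..<x + 1}"])
    fix y assume "y \<in> {x - 1<..<x + 1}"
    then show "indef_integral f (x - 1) + integral {x - 1..y} f = indef_integral f y"
      using indef_integral_has_integral[OF loc_integrable_continuous[OF f], of "x - 1" y]
      by (auto simp: integral_unique)
  qed auto
qed

lemma indef_integral_subtract:
  assumes "loc_integrable f" "loc_integrable g"
  shows "indef_integral (\<lambda>x. f x - g x) x = indef_integral f x - indef_integral g x"
  using assms by (simp add: indef_integral_def loc_integrable_integrable_on integral_diff)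

lemma abs_indef_integral_le:
  assumes h: "loc_integrable h" and G: "ac_primitive G g" and le: "\<And>x. \<bar>h x\<bar> \<le> g x" and "G 0 = 0"
  shows "\<bar>indef_integral h x\<bar> \<le> \<bar>G x\<bar>"
proof -
  have *: "\<bar>indef_integral h b - indef_integral h a\<bar> \<le> \<bar>G b - G a\<bar>" if "a \<le> b" for a b
  proof -
    have "norm (integral {a..b} h) \<le> integral {a..b} g"
      using le h ac_primitive_has_integral[OF G that]
      by (intro Henstock_Kurzweil_Integration.integral_norm_bound_integral)
        (auto simp: loc_integrable_integrable_on)
    then show ?thesis
      using indef_integral_has_integral[OF h that] ac_primitive_has_integral[OF G that]
      by (simp add: integral_unique)
  qed
  show ?thesis using *[of 0 x] *[of x 0] \<open>G 0 = 0\<close> by (cases "x \<ge> 0") auto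
qed

text \<open>With \<open>k = 1 + \<bar>q\<bar>\<close> and \<open>K\<close> its indefinite integral, the Picard operator is a contraction on the whole
  line for the sup norm weighted by \<open>W = cosh (4 K)\<close>: the integral of \<open>k W\<close> from \<open>0\<close> is
  \<open>sinh (4 K) / 4\<close>, which is at most \<open>W / 4\<close> on both half-lines.\<close>

lemma ode_integral_system_solution:
  assumes q: "loc_integrable q"
  obtains u v where "continuous_on UNIV u" "continuous_on UNIV v"
    "\<And>x. u x = a + indef_integral v x" "\<And>x. v x = b + indef_integral (\<lambda>s. q s * u s) x"
proof -
  define k where "k x = 1 + \<bar>q x\<bar>" for x
  define K where "K = indef_integral k"
  define W where "W x = cosh (4 * K x)" for x
  have k: "loc_integrable k"
    unfolding k_def by (intro loc_integrable_add loc_integrable_abs q) (auto intro: loc_integrable_continuous)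
  have K: "ac_primitive K k" unfolding K_def by (rule ac_primitive_indef_integral[OF k])
  have cW: "continuous_on UNIV W"
    unfolding W_def by (intro continuous_intros ac_primitive_continuous[OF K])
  have W1: "W x \<ge> 1" for x unfolding W_def by (rule cosh_real_ge_1)
  have W0: "W x > 0" "W x \<noteq> 0" for x using W1[of x] by auto
  have bound: "\<bar>indef_integral h x\<bar> \<le> c * W x / 4"
    if h: "loc_integrable h" and le: "\<And>x. \<bar>h x\<bar> \<le> c * (W x * k x)" and "c \<ge> 0" for h c x
  proof -
    have "ac_primitive (\<lambda>x. c * (sinh (4 * K x) / 4)) (\<lambda>x. c * cosh (4 * K x) * k x)"
      by (rule ac_primitive_compose_C1[OF K, of "\<lambda>y. c * (sinh (4 * y) / 4)" "\<lambda>y. c * cosh (4 * y)"])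
        (auto intro!: derivative_eq_intros continuous_intros)
    then have "\<bar>indef_integral h x\<bar> \<le> \<bar>c * (sinh (4 * K x) / 4)\<bar>"
      using le by (intro abs_indef_integral_le[OF h]) (auto simp: W_def K_def mult.assoc)
    also have "\<dots> \<le> c * W x / 4"
    proof -
      have "\<bar>sinh y\<bar> \<le> cosh y" for y :: real
        using sinh_less_cosh_real[of y] sinh_less_cosh_real[of "- y"] by simp
      then show ?thesis using \<open>c \<ge> 0\<close> by (auto simp: abs_mult W_def mult_left_mono)
    qed
    finally show ?thesis .
  qed
  \<comment> \<open>The unknown \<open>Z\<close> is the pair of \<open>u\<close> and
    \<open>v\<close> divided by \<open>W\<close>, so the weighted norm becomes the sup norm of the
    complete space of bounded continuous functions. \<open>h1\<close> and \<open>h2\<close> are the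
    right-hand sides of the system in terms of \<open>Z\<close>.\<close>
  define h1 :: "(real \<Rightarrow>\<^sub>C (real \<times> real)) \<Rightarrow> real \<Rightarrow> real" where "h1 Z s = W s * snd (Z s)" for Z s
  define h2 :: "(real \<Rightarrow>\<^sub>C (real \<times> real)) \<Rightarrow> real \<Rightarrow> real" where "h2 Z s = q s * (W s * fst (Z s))" for Z s
  have l1: "loc_integrable (h1 Z)" for Z
    unfolding h1_def by (intro loc_integrable_continuous continuous_intros cW) auto
  have l2: "loc_integrable (h2 Z)" for Z
    unfolding h2_def by (intro loc_integrable_mult_continuous[OF q] continuous_intros cW) auto
  define T0 where "T0 Z x = ((a + indef_integral (h1 Z) x) / W x, (b + indef_integral (h2 Z) x) / W x)" for Z x
  \<comment> \<open>\<open>k\<close> dominates both coefficients of the system, 1 and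
    \<open>\<bar>q s\<bar>\<close>.\<close>
  have key: "\<bar>indef_integral (\<lambda>s. W s * p s) x / W x\<bar> \<le> c / 4"
      "\<bar>indef_integral (\<lambda>s. q s * (W s * p s)) x / W x\<bar> \<le> c / 4"
    if p: "continuous_on UNIV p" and le: "\<And>s. \<bar>p s\<bar> \<le> c" for p c x
  proof -
    have c0: "c \<ge> 0" using le[of 0] by linarith
    have "\<bar>W s * p s\<bar> \<le> c * (W s * k s)" for s
    proof -
      have "\<bar>W s * p s\<bar> = \<bar>p s\<bar> * (W s * 1)" using W0(1)[of s] by (simp add: abs_mult)
      also have "\<dots> \<le> c * (W s * k s)"
        using W0(1)[of s] le[of s] c0 by (intro mult_mono) (auto simp: k_def)
      finally show ?thesis .
    qed
    then have "\<bar>indef_integral (\<lambda>s. W s * p s) x\<bar> \<le> c * W x / 4"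
      using c0 by (intro bound loc_integrable_continuous continuous_intros cW p) auto
    then show "\<bar>indef_integral (\<lambda>s. W s * p s) x / W x\<bar> \<le> c / 4"
      using W0(1)[of x] by (simp add: abs_divide divide_le_eq)
    have "\<bar>q s * (W s * p s)\<bar> \<le> c * (W s * k s)" for s
    proof -
      have "\<bar>q s * (W s * p s)\<bar> = \<bar>p s\<bar> * (W s * \<bar>q s\<bar>)" using W0(1)[of s] by (simp add: abs_mult)
      also have "\<dots> \<le> c * (W s * k s)"
        using W0(1)[of s] le[of s] c0 by (intro mult_mono) (auto simp: k_def)
      finally show ?thesis .
    qed
    then have "\<bar>indef_integral (\<lambda>s. q s * (W s * p s)) x\<bar> \<le> c * W x / 4"
      using c0 by (intro bound loc_integrable_mult_continuous[OF q] continuous_intros cW p) auto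
    then show "\<bar>indef_integral (\<lambda>s. q s * (W s * p s)) x / W x\<bar> \<le> c / 4"
      using W0(1)[of x] by (simp add: abs_divide divide_le_eq)
  qed
  have comp: "\<bar>fst z\<bar> \<le> norm z" "\<bar>snd z\<bar> \<le> norm z" for z :: "real \<times> real"
    using norm_fst_le[of "fst z" "snd z"] norm_snd_le[of "snd z" "fst z"] by auto
  have T0: "T0 Z \<in> bcontfun" for Z
  proof (rule bcontfun_normI)
    have "continuous_on UNIV (indef_integral (h1 Z))" "continuous_on UNIV (indef_integral (h2 Z))"
      using l1 l2 ac_primitive_continuous ac_primitive_indef_integral by blast+
    then show "continuous_on UNIV (T0 Z)"
      unfolding T0_def by (intro continuous_intros cW) (use W0 in auto)
    fix x
    have "norm (T0 Z x) \<le> \<bar>(a + indef_integral (h1 Z) x) / W x\<bar> + \<bar>(b + indef_integral (h2 Z) x) / W x\<bar>"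
      unfolding T0_def using norm_Pair_le by (metis real_norm_def)
    moreover have "\<bar>(a + indef_integral (h1 Z) x) / W x\<bar> \<le> \<bar>a\<bar> + \<bar>indef_integral (h1 Z) x / W x\<bar>"
    proof -
      have "\<bar>a / W x\<bar> \<le> \<bar>a\<bar>" using W1[of x] by (simp add: abs_divide divide_le_eq mult_le_cancel_left1)
      then show ?thesis unfolding add_divide_distrib by linarith
    qed
    moreover have "\<bar>(b + indef_integral (h2 Z) x) / W x\<bar> \<le> \<bar>b\<bar> + \<bar>indef_integral (h2 Z) x / W x\<bar>"
    proof -
      have "\<bar>b / W x\<bar> \<le> \<bar>b\<bar>" using W1[of x] by (simp add: abs_divide divide_le_eq mult_le_cancel_left1)
      then show ?thesis unfolding add_divide_distrib by linarith
    qed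
    moreover have "\<bar>indef_integral (h1 Z) x / W x\<bar> \<le> norm Z / 4"
      unfolding h1_def by (rule key(1)) (auto intro!: continuous_intros order_trans[OF comp(2) norm_bounded])
    moreover have "\<bar>indef_integral (h2 Z) x / W x\<bar> \<le> norm Z / 4"
      unfolding h2_def by (rule key(2)) (auto intro!: continuous_intros order_trans[OF comp(1) norm_bounded])
    ultimately show "norm (T0 Z x) \<le> \<bar>a\<bar> + norm Z / 4 + (\<bar>b\<bar> + norm Z / 4)" by linarith
  qed
  define T where "T Z = Bcontfun (T0 Z)" for Z
  have T: "apply_bcontfun (T Z) x = T0 Z x" for Z x
    using T0 by (simp add: T_def Bcontfun_inverse)
  \<comment> \<open>Each component contracts by 1/4, and the norm of a pair is at most the sum of
    its parts.\<close>
  have "dist (T Y) (T Z) \<le> (1/2) * dist Y Z" for Y Z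
  proof (rule dist_bound)
    fix x
    define p1 where "p1 s = snd (apply_bcontfun Y s) - snd (apply_bcontfun Z s)" for s
    define p2 where "p2 s = fst (apply_bcontfun Y s) - fst (apply_bcontfun Z s)" for s
    define d1 where "d1 = indef_integral (\<lambda>s. W s * p1 s) x / W x"
    define d2 where "d2 = indef_integral (\<lambda>s. q s * (W s * p2 s)) x / W x"
    have "indef_integral (\<lambda>s. W s * p1 s) x = indef_integral (h1 Y) x - indef_integral (h1 Z) x"
      using indef_integral_subtract[OF l1 l1, of Y Z x] unfolding h1_def p1_def right_diff_distrib .
    moreover have "indef_integral (\<lambda>s. q s * (W s * p2 s)) x = indef_integral (h2 Y) x - indef_integral (h2 Z) x"
      using indef_integral_subtract[OF l2 l2, of Y Z x] unfolding h2_def p2_def right_diff_distrib .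
    ultimately have "T0 Y x - T0 Z x = (d1, d2)"
      by (simp add: T0_def d1_def d2_def diff_divide_distrib add_divide_distrib)
    then have "dist (T0 Y x) (T0 Z x) \<le> \<bar>d1\<bar> + \<bar>d2\<bar>"
      using norm_Pair_le[of d1 d2] by (simp add: dist_norm)
    moreover have "\<bar>d1\<bar> \<le> dist Y Z / 4"
      unfolding d1_def
    proof (rule key(1))
      show "\<bar>p1 s\<bar> \<le> dist Y Z" for s
        using dist_snd_le[of "apply_bcontfun Y s" "apply_bcontfun Z s"] dist_bounded[of Y s Z]
        by (simp add: p1_def dist_real_def)
    qed (auto intro!: continuous_intros simp: p1_def)
    moreover have "\<bar>d2\<bar> \<le> dist Y Z / 4"
      unfolding d2_def
    proof (rule key(2))
      show "\<bar>p2 s\<bar> \<le> dist Y Z" for s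
        using dist_fst_le[of "apply_bcontfun Y s" "apply_bcontfun Z s"] dist_bounded[of Y s Z]
        by (simp add: p2_def dist_real_def)
    qed (auto intro!: continuous_intros simp: p2_def)
    ultimately show "dist (apply_bcontfun (T Y) x) (apply_bcontfun (T Z) x) \<le> (1/2) * dist Y Z"
      unfolding T by linarith
  qed
  then obtain Z where "T Z = Z"
    using banach_fix_type[of "1/2" T] by auto
  then have Z: "Z x = T0 Z x" for x using T[of Z x] by simp
  show thesis
  proof (rule that[of "\<lambda>x. W x * fst (Z x)" "\<lambda>x. W x * snd (Z x)"])
    show "W x * fst (Z x) = a + indef_integral (\<lambda>x. W x * snd (Z x)) x" for x
      using Z[of x] W0[of x] by (simp add: T0_def h1_def[abs_def])
    show "W x * snd (Z x) = b + indef_integral (\<lambda>s. q s * (W s * fst (Z s))) x" for x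
      using Z[of x] W0[of x] by (simp add: T0_def h2_def[abs_def])
  qed (auto intro!: continuous_intros cW)
qed

lemma ode_solution_exists:
  assumes q: "loc_integrable q"
  obtains u v where "ode_solution q u v" "u 0 = a" "v 0 = b"
proof -
  obtain u v where uv: "continuous_on UNIV u" "continuous_on UNIV v"
    "\<And>x. u x = a + indef_integral v x" "\<And>x. v x = b + indef_integral (\<lambda>s. q s * u s) x"
    using ode_integral_system_solution[OF q] by blast
  have "((\<lambda>x. a + indef_integral v x) has_real_derivative v x) (at x)" for x
    using indef_integral_has_real_derivative[OF uv(2)] by (auto intro!: derivative_eq_intros)
  moreover have "(\<lambda>x. a + indef_integral v x) = u" using uv(3) by auto
  ultimately have "(u has_real_derivative v x) (at x)" for x by simp
  moreover have "ac_primitive (\<lambda>x. b + indef_integral (\<lambda>s. q s * u s) x) (\<lambda>x. q x * u x)"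
    using q uv(1) by (intro ac_primitive_shift ac_primitive_indef_integral loc_integrable_mult_continuous)
  moreover have "(\<lambda>x. b + indef_integral (\<lambda>s. q s * u s) x) = v" using uv(4) by auto
  ultimately have "ode_solution q u v" by (simp add: ode_solution_def)
  then show thesis using that uv(3)[of 0] uv(4)[of 0] by simp
qed

section \<open>Variation of parameters and the discriminant\<close>

text \<open>The solutions are the columns of a matrix that is the identity at 0. The trace
  \<open>\<phi>\<^sub>1 p + \<psi>\<^sub>2 p\<close> of its value at \<open>p\<close> is the
  discriminant.\<close>

definition fundamental_system where
  "fundamental_system q \<phi>\<^sub>1 \<psi>\<^sub>1 \<phi>\<^sub>2 \<psi>\<^sub>2 \<longleftrightarrow>
     ode_solution q \<phi>\<^sub>1 \<psi>\<^sub>1 \<and> \<phi>\<^sub>1 0 = 1 \<and> \<psi>\<^sub>1 0 = 0 \<and>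
     ode_solution q \<phi>\<^sub>2 \<psi>\<^sub>2 \<and> \<phi>\<^sub>2 0 = 0 \<and> \<psi>\<^sub>2 0 = 1"

section \<open>Wronskian identities\<close>

lemma ac_primitive_zero_constant:
  assumes "ac_primitive F (\<lambda>x. 0)"
  shows "F x = F y"
proof -
  have "F b = F a" if "a \<le> b" for a b
    using ac_primitive_has_integral[OF assms that] has_integral_0 has_integral_unique
    by (metis eq_iff_diff_eq_0)
  then show ?thesis by (cases "x \<le> y") auto
qed

lemma ode_solution_continuous:
  assumes "ode_solution q u v"
  shows "continuous_on S u" "continuous_on S v"
  using assms DERIV_isCont ac_primitive_continuous
  unfolding ode_solution_def by (blast intro: continuous_at_imp_continuous_on)+

text \<open>The two functions solve different equations, and in the derivative of their Wronskian
  all but the difference \<open>r\<close> cancels. Taking \<open>r = 0\<close> gives conservation,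
  general \<open>r\<close> gives variation of parameters.\<close>

lemma ac_primitive_wronskian:
  assumes u: "ode_solution (\<lambda>x. q x + r x) u v" and \<phi>: "ode_solution q \<phi> \<psi>"
  shows "ac_primitive (\<lambda>x. u x * \<psi> x - v x * \<phi> x) (\<lambda>x. - (r x * (u x * \<phi> x)))"
proof -
  have "ac_primitive u v" "ac_primitive \<phi> \<psi>"
    using u \<phi> ode_solution_continuous[OF u] ode_solution_continuous[OF \<phi>]
    by (auto simp: ode_solution_def intro: ac_primitive_C1)
  then have "ac_primitive (\<lambda>x. u x * \<psi> x - v x * \<phi> x)
      (\<lambda>x. (v x * \<psi> x + u x * (q x * \<phi> x)) - ((q x + r x) * u x * \<phi> x + v x * \<psi> x))"
    using u \<phi> by (intro ac_primitive_diff ac_primitive_mult) (auto simp: ode_solution_def)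
  then show ?thesis by (simp add: algebra_simps)
qed

lemma wronskian_constant:
  assumes "ode_solution q u v" "ode_solution q \<phi> \<psi>"
  shows "u x * \<psi> x - v x * \<phi> x = u 0 * \<psi> 0 - v 0 * \<phi> 0"
proof -
  have "ac_primitive (\<lambda>x. u x * \<psi> x - v x * \<phi> x) (\<lambda>x. 0)"
    using ac_primitive_wronskian[of q "\<lambda>x. 0" u v \<phi> \<psi>] assms by simp
  then show ?thesis by (rule ac_primitive_zero_constant)
qed

lemma fundamental_system_det:
  assumes "fundamental_system q \<phi>\<^sub>1 \<psi>\<^sub>1 \<phi>\<^sub>2 \<psi>\<^sub>2"
  shows "\<phi>\<^sub>1 x * \<psi>\<^sub>2 x - \<phi>\<^sub>2 x * \<psi>\<^sub>1 x = 1"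
  using wronskian_constant[of q \<phi>\<^sub>1 \<psi>\<^sub>1 \<phi>\<^sub>2 \<psi>\<^sub>2 x] assms
  by (simp add: fundamental_system_def mult.commute)

text \<open>Cramer's rule: a vector is recovered from its Wronskians with the two columns of a
  unimodular matrix.\<close>

lemma wronskian_cramer:
  fixes a b c d x y :: real
  assumes "a * d - b * c = 1" and s: "x * c - y * a = s" and t: "x * d - y * b = t"
  shows "x = a * t - b * s" "y = c * t - d * s"
proof -
  have "a * t - b * s = x * (a * d - b * c)" "c * t - d * s = y * (a * d - b * c)"
    by (simp_all add: algebra_simps flip: s t)
  then show "x = a * t - b * s" "y = c * t - d * s" using assms by simp_all
qed

text \<open>Uniqueness for the initial value problem without a Gronwall estimate: the constant
  Wronskians with both basis solutions determine \<open>u\<close> and \<open>v\<close>.\<close>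

lemma fundamental_system_span:
  assumes F: "fundamental_system q \<phi>\<^sub>1 \<psi>\<^sub>1 \<phi>\<^sub>2 \<psi>\<^sub>2" and u: "ode_solution q u v"
  shows "u x = \<phi>\<^sub>1 x * u 0 + \<phi>\<^sub>2 x * v 0" "v x = \<psi>\<^sub>1 x * u 0 + \<psi>\<^sub>2 x * v 0"
proof -
  have W: "u x * \<psi>\<^sub>1 x - v x * \<phi>\<^sub>1 x = - v 0" "u x * \<psi>\<^sub>2 x - v x * \<phi>\<^sub>2 x = u 0"
    using wronskian_constant[OF u, of \<phi>\<^sub>1 \<psi>\<^sub>1 x] wronskian_constant[OF u, of \<phi>\<^sub>2 \<psi>\<^sub>2 x] F
    by (simp_all add: fundamental_system_def)
  show "u x = \<phi>\<^sub>1 x * u 0 + \<phi>\<^sub>2 x * v 0" "v x = \<psi>\<^sub>1 x * u 0 + \<psi>\<^sub>2 x * v 0"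
    using wronskian_cramer[OF fundamental_system_det[OF F, of x] W] by linarith+
qed

text \<open>No ansatz is made: integrating the Wronskian identity from 0 to \<open>x\<close> yields
  the Wronskians with both basis solutions at \<open>x\<close>, and Cramer's rule solves for
  \<open>u\<close> and \<open>v\<close>.\<close>

lemma duhamel:
  assumes F: "fundamental_system q \<phi>\<^sub>1 \<psi>\<^sub>1 \<phi>\<^sub>2 \<psi>\<^sub>2" and u: "ode_solution (\<lambda>x. q x + r x) u v"
    and "0 \<le> x"
  defines "I \<equiv> \<lambda>\<phi>. integral {0..x} (\<lambda>s. r s * (u s * \<phi> s))"
  shows "u x = \<phi>\<^sub>1 x * (u 0 - I \<phi>\<^sub>2) + \<phi>\<^sub>2 x * (v 0 + I \<phi>\<^sub>1)"
    and "v x = \<psi>\<^sub>1 x * (u 0 - I \<phi>\<^sub>2) + \<psi>\<^sub>2 x * (v 0 + I \<phi>\<^sub>1)"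
proof -
  have I: "u x * \<psi> x - v x * \<phi> x = u 0 * \<psi> 0 - v 0 * \<phi> 0 - I \<phi>" if "ode_solution q \<phi> \<psi>" for \<phi> \<psi>
    using has_integral_neg[OF ac_primitive_has_integral[OF ac_primitive_wronskian[OF u that] \<open>0 \<le> x\<close>]]
    by (simp add: I_def integral_unique)
  have W: "u x * \<psi>\<^sub>1 x - v x * \<phi>\<^sub>1 x = - (v 0 + I \<phi>\<^sub>1)" "u x * \<psi>\<^sub>2 x - v x * \<phi>\<^sub>2 x = u 0 - I \<phi>\<^sub>2"
    using I[of \<phi>\<^sub>1 \<psi>\<^sub>1] I[of \<phi>\<^sub>2 \<psi>\<^sub>2] F by (simp_all add: fundamental_system_def)
  show "u x = \<phi>\<^sub>1 x * (u 0 - I \<phi>\<^sub>2) + \<phi>\<^sub>2 x * (v 0 + I \<phi>\<^sub>1)"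
    "v x = \<psi>\<^sub>1 x * (u 0 - I \<phi>\<^sub>2) + \<psi>\<^sub>2 x * (v 0 + I \<phi>\<^sub>1)"
    using wronskian_cramer[OF fundamental_system_det[OF F, of x] W] by linarith+
qed

text \<open>If the coefficients agree on the open interval, the Duhamel integrand vanishes off its
  endpoints. A stretch of the line potential can thus be exchanged for a one-letter
  potential.\<close>

lemma fundamental_system_span_local:
  assumes F: "fundamental_system q \<phi>\<^sub>1 \<psi>\<^sub>1 \<phi>\<^sub>2 \<psi>\<^sub>2" and u: "ode_solution q' u v"
    and eq: "\<And>s. s \<in> {0<..<p} \<Longrightarrow> q' s = q s" and x: "x \<in> {0..p}"
  shows "u x = \<phi>\<^sub>1 x * u 0 + \<phi>\<^sub>2 x * v 0" "v x = \<psi>\<^sub>1 x * u 0 + \<psi>\<^sub>2 x * v 0"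
proof -
  define r where "r s = q' s - q s" for s
  have u': "ode_solution (\<lambda>x. q x + r x) u v" using u by (simp add: r_def)
  have I: "integral {0..x} (\<lambda>s. r s * (u s * \<phi> s)) = 0" for \<phi>
  proof -
    have "integral {0..x} (\<lambda>s. r s * (u s * \<phi> s)) = integral {0..x} (\<lambda>s. 0)"
      using eq x by (intro integral_spike[of "{0, p}"]) (auto simp: r_def)
    then show ?thesis by simp
  qed
  show "u x = \<phi>\<^sub>1 x * u 0 + \<phi>\<^sub>2 x * v 0" "v x = \<psi>\<^sub>1 x * u 0 + \<psi>\<^sub>2 x * v 0"
    using duhamel[OF F u', of x] x by (simp_all add: I)
qed

lemma abs_integral_mult_le:
  assumes r: "loc_integrable r" and cont: "continuous_on UNIV u" "continuous_on UNIV \<phi>"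
    and le: "\<And>s. s \<in> {0..p} \<Longrightarrow> \<bar>u s\<bar> \<le> M" "\<And>s. s \<in> {0..p} \<Longrightarrow> \<bar>\<phi> s\<bar> \<le> c"
    and x: "x \<in> {0..p}"
  shows "\<bar>integral {0..x} (\<lambda>s. r s * (u s * \<phi> s))\<bar> \<le> integral {0..p} (\<lambda>s. \<bar>r s\<bar>) * (M * c)"
proof -
  have M: "0 \<le> M" "0 \<le> c" using le[of x] x by linarith+
  have int: "(\<lambda>s. \<bar>r s\<bar>) integrable_on {a..b}" for a b
    by (intro loc_integrable_integrable_on loc_integrable_abs r)
  have "norm (integral {0..x} (\<lambda>s. r s * (u s * \<phi> s))) \<le> integral {0..x} (\<lambda>s. \<bar>r s\<bar> * (M * c))"
  proof (rule Henstock_Kurzweil_Integration.integral_norm_bound_integral)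
    show "(\<lambda>s. r s * (u s * \<phi> s)) integrable_on {0..x}"
      using r cont by (intro loc_integrable_integrable_on loc_integrable_mult_continuous continuous_intros)
    show "(\<lambda>s. \<bar>r s\<bar> * (M * c)) integrable_on {0..x}"
      using int by (rule integrable_on_mult_left)
    fix s assume "s \<in> {0..x}"
    then show "norm (r s * (u s * \<phi> s)) \<le> \<bar>r s\<bar> * (M * c)"
      using le[of s] x M by (auto simp: abs_mult intro!: mult_left_mono mult_mono)
  qed
  also have "\<dots> = integral {0..x} (\<lambda>s. \<bar>r s\<bar>) * (M * c)" by simp
  also have "\<dots> \<le> integral {0..p} (\<lambda>s. \<bar>r s\<bar>) * (M * c)"
    using x M int by (intro mult_right_mono integral_subset_le) auto
  finally show ?thesis by simp
qed

text \<open>Absorption: at a maximum point \<open>y\<close> of \<open>\<bar>u\<bar>\<close> the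
  integral terms in the Duhamel formula are at most \<open>\<bar>u y\<bar> / 2\<close> by the
  smallness condition, and move to the left-hand side.\<close>

lemma perturbed_solution_bound:
  assumes F: "fundamental_system q \<phi>\<^sub>1 \<psi>\<^sub>1 \<phi>\<^sub>2 \<psi>\<^sub>2" and u: "ode_solution (\<lambda>x. q x + r x) u v"
    and r: "loc_integrable r" and x: "x \<in> {0..p}"
    and a: "\<And>s. s \<in> {0..p} \<Longrightarrow> \<bar>\<phi>\<^sub>1 s\<bar> \<le> a" and b: "\<And>s. s \<in> {0..p} \<Longrightarrow> \<bar>\<phi>\<^sub>2 s\<bar> \<le> b"
    and small: "4 * a * b * integral {0..p} (\<lambda>s. \<bar>r s\<bar>) \<le> 1"
  shows "\<bar>u x\<bar> \<le> 2 * (a * \<bar>u 0\<bar> + b * \<bar>v 0\<bar>)"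
proof -
  define R where "R = integral {0..p} (\<lambda>s. \<bar>r s\<bar>)"
  define I where "I \<phi> y = integral {0..y} (\<lambda>s. r s * (u s * \<phi> s))" for \<phi> y
  have ab: "a \<ge> 0" "b \<ge> 0" using a[of x] b[of x] x by linarith+
  have cont: "continuous_on UNIV u" "continuous_on UNIV \<phi>\<^sub>1" "continuous_on UNIV \<phi>\<^sub>2"
    using u F ode_solution_continuous(1) unfolding fundamental_system_def by blast+
  have "continuous_on {0..p} (\<lambda>s. \<bar>u s\<bar>)"
    using cont(1) continuous_on_subset by (intro continuous_intros) auto
  moreover have "{0..p} \<noteq> {}" using x by auto
  ultimately obtain y where y: "y \<in> {0..p}" "\<And>s. s \<in> {0..p} \<Longrightarrow> \<bar>u s\<bar> \<le> \<bar>u y\<bar>"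
    using continuous_attains_sup[of "{0..p}" "\<lambda>s. \<bar>u s\<bar>"] compact_Icc by blast
  have I: "\<bar>I \<phi>\<^sub>1 y\<bar> \<le> R * (\<bar>u y\<bar> * a)" "\<bar>I \<phi>\<^sub>2 y\<bar> \<le> R * (\<bar>u y\<bar> * b)"
    unfolding I_def R_def using y a b by (auto intro!: abs_integral_mult_le r cont)
  have "u y = \<phi>\<^sub>1 y * (u 0 - I \<phi>\<^sub>2 y) + \<phi>\<^sub>2 y * (v 0 + I \<phi>\<^sub>1 y)"
    using duhamel(1)[OF F u, of y] y(1) by (simp add: I_def)
  also have "\<bar>\<dots>\<bar> \<le> \<bar>\<phi>\<^sub>1 y\<bar> * (\<bar>u 0\<bar> + \<bar>I \<phi>\<^sub>2 y\<bar>) + \<bar>\<phi>\<^sub>2 y\<bar> * (\<bar>v 0\<bar> + \<bar>I \<phi>\<^sub>1 y\<bar>)"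
    by (rule order_trans[OF abs_triangle_ineq]) (auto simp: abs_mult intro!: add_mono mult_left_mono)
  also have "\<dots> \<le> a * (\<bar>u 0\<bar> + R * (\<bar>u y\<bar> * b)) + b * (\<bar>v 0\<bar> + R * (\<bar>u y\<bar> * a))"
    using a[OF y(1)] b[OF y(1)] I ab by (intro add_mono mult_mono) auto
  also have "\<dots> = a * \<bar>u 0\<bar> + b * \<bar>v 0\<bar> + (4 * a * b * R) * (\<bar>u y\<bar> / 2)" by (simp add: algebra_simps)
  also have "\<dots> \<le> a * \<bar>u 0\<bar> + b * \<bar>v 0\<bar> + 1 * (\<bar>u y\<bar> / 2)"
    using small by (intro add_left_mono mult_right_mono) (auto simp: R_def)
  finally have "\<bar>u y\<bar> \<le> 2 * (a * \<bar>u 0\<bar> + b * \<bar>v 0\<bar>)" by simp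
  then show ?thesis using y(2)[OF x] by linarith
qed

text \<open>The four entries keep separate bounds because for the free equation at energy
  \<open>k\<^sup>2\<close> they have sizes 1, 1/k, k and 1. Every error term carries a factor
  \<open>b\<close>, which is the 1/k that makes the error decay.\<close>

lemma discriminant_perturbation:
  assumes F: "fundamental_system q \<phi>\<^sub>1 \<psi>\<^sub>1 \<phi>\<^sub>2 \<psi>\<^sub>2"
    and U: "fundamental_system (\<lambda>x. q x + r x) u\<^sub>1 v\<^sub>1 u\<^sub>2 v\<^sub>2"
    and r: "loc_integrable r" and "0 \<le> p"
    and a: "\<And>s. s \<in> {0..p} \<Longrightarrow> \<bar>\<phi>\<^sub>1 s\<bar> \<le> a" and b: "\<And>s. s \<in> {0..p} \<Longrightarrow> \<bar>\<phi>\<^sub>2 s\<bar> \<le> b"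
    and a': "\<bar>\<psi>\<^sub>1 p\<bar> \<le> a'" and b': "\<bar>\<psi>\<^sub>2 p\<bar> \<le> b'"
    and R: "integral {0..p} (\<lambda>s. \<bar>r s\<bar>) \<le> R" and small: "4 * a * b * R \<le> 1"
  shows "\<bar>(u\<^sub>1 p + v\<^sub>2 p) - (\<phi>\<^sub>1 p + \<psi>\<^sub>2 p)\<bar> \<le> 2 * b * R * (2 * a * a + a' * b + b' * a)"
proof -
  define R0 where "R0 = integral {0..p} (\<lambda>s. \<bar>r s\<bar>)"
  define I where "I u \<phi> = integral {0..p} (\<lambda>s. r s * (u s * \<phi> s))" for u \<phi>
  have p: "p \<in> {0..p}" using \<open>0 \<le> p\<close> by auto
  have nn: "a \<ge> 0" "b \<ge> 0" "a' \<ge> 0" "b' \<ge> 0" using a[OF p] b[OF p] a' b' by linarith+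
  have R0: "0 \<le> R0" "R0 \<le> R"
    using R r by (auto simp: R0_def intro!: integral_nonneg loc_integrable_integrable_on loc_integrable_abs)
  have small': "4 * a * b * integral {0..p} (\<lambda>s. \<bar>r s\<bar>) \<le> 1"
    using mult_left_mono[OF R0(2), of "4 * a * b"] nn small by (auto simp: R0_def)
  note Fd = F[unfolded fundamental_system_def] and Ud = U[unfolded fundamental_system_def]
  have u1: "\<bar>u\<^sub>1 x\<bar> \<le> 2 * a" if "x \<in> {0..p}" for x
    using perturbed_solution_bound[OF F _ r that a b small', of u\<^sub>1 v\<^sub>1] Ud by simp
  have u2: "\<bar>u\<^sub>2 x\<bar> \<le> 2 * b" if "x \<in> {0..p}" for x
    using perturbed_solution_bound[OF F _ r that a b small', of u\<^sub>2 v\<^sub>2] Ud by simp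
  have cont: "continuous_on UNIV u\<^sub>1" "continuous_on UNIV u\<^sub>2" "continuous_on UNIV \<phi>\<^sub>1" "continuous_on UNIV \<phi>\<^sub>2"
    using Fd Ud ode_solution_continuous(1) by blast+
  have I: "\<bar>I u \<phi>\<bar> \<le> R * (m * c)"
    if "continuous_on UNIV u" "continuous_on UNIV \<phi>" "\<And>s. s \<in> {0..p} \<Longrightarrow> \<bar>u s\<bar> \<le> m"
      "\<And>s. s \<in> {0..p} \<Longrightarrow> \<bar>\<phi> s\<bar> \<le> c" for u \<phi> m c
  proof -
    have "\<bar>I u \<phi>\<bar> \<le> R0 * (m * c)"
      unfolding I_def R0_def by (rule abs_integral_mult_le[OF r that p])
    also have "\<dots> \<le> R * (m * c)"
    proof (rule mult_right_mono[OF R0(2)])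
      have "0 \<le> m" "0 \<le> c" using that(3,4)[OF p] by linarith+
      then show "0 \<le> m * c" by simp
    qed
    finally show ?thesis .
  qed
  have "u\<^sub>1 p = \<phi>\<^sub>1 p * (1 - I u\<^sub>1 \<phi>\<^sub>2) + \<phi>\<^sub>2 p * (0 + I u\<^sub>1 \<phi>\<^sub>1)"
    using duhamel(1)[OF F _ \<open>0 \<le> p\<close>, of r u\<^sub>1 v\<^sub>1] Ud by (simp add: I_def)
  moreover have "v\<^sub>2 p = \<psi>\<^sub>1 p * (0 - I u\<^sub>2 \<phi>\<^sub>2) + \<psi>\<^sub>2 p * (1 + I u\<^sub>2 \<phi>\<^sub>1)"
    using duhamel(2)[OF F _ \<open>0 \<le> p\<close>, of r u\<^sub>2 v\<^sub>2] Ud by (simp add: I_def)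
  ultimately have "(u\<^sub>1 p + v\<^sub>2 p) - (\<phi>\<^sub>1 p + \<psi>\<^sub>2 p)
      = \<phi>\<^sub>2 p * I u\<^sub>1 \<phi>\<^sub>1 - \<phi>\<^sub>1 p * I u\<^sub>1 \<phi>\<^sub>2 + (\<psi>\<^sub>2 p * I u\<^sub>2 \<phi>\<^sub>1 - \<psi>\<^sub>1 p * I u\<^sub>2 \<phi>\<^sub>2)"
    by (simp add: algebra_simps)
  then have "\<bar>(u\<^sub>1 p + v\<^sub>2 p) - (\<phi>\<^sub>1 p + \<psi>\<^sub>2 p)\<bar>
      \<le> \<bar>\<phi>\<^sub>2 p * I u\<^sub>1 \<phi>\<^sub>1\<bar> + \<bar>\<phi>\<^sub>1 p * I u\<^sub>1 \<phi>\<^sub>2\<bar> + (\<bar>\<psi>\<^sub>2 p * I u\<^sub>2 \<phi>\<^sub>1\<bar> + \<bar>\<psi>\<^sub>1 p * I u\<^sub>2 \<phi>\<^sub>2\<bar>)"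
    by linarith
  also have "\<dots> \<le> b * (R * (2 * a * a)) + a * (R * (2 * a * b)) + (b' * (R * (2 * b * a)) + a' * (R * (2 * b * b)))"
    unfolding abs_mult
    using a[OF p] b[OF p] a' b' nn \<open>0 \<le> p\<close> by (intro add_mono mult_mono I cont u1 u2 a b) auto
  also have "\<dots> = 2 * b * R * (2 * a * a + a' * b + b' * a)" by (simp add: algebra_simps)
  finally show ?thesis .
qed

text \<open>Moving the energy from \<open>E0\<close> to \<open>E\<close> is a perturbation by the
  constant \<open>E0 - E\<close>.\<close>

lemma discriminant_continuous:
  assumes q: "loc_integrable q" and "0 \<le> p"
    and U: "\<And>E. fundamental_system (\<lambda>x. q x - E) (u\<^sub>1 E) (v\<^sub>1 E) (u\<^sub>2 E) (v\<^sub>2 E)"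
  shows "continuous_on UNIV (\<lambda>E. u\<^sub>1 E p + v\<^sub>2 E p)"
  unfolding continuous_on_eq_continuous_at[OF open_UNIV]
proof
  fix E0
  note Ud = U[of E0, unfolded fundamental_system_def]
  have bd: "\<exists>M. \<forall>s\<in>{0..p}. \<bar>f s\<bar> \<le> M" if "continuous_on {0..p} f" for f :: "real \<Rightarrow> real"
    using continuous_on_interval_bounded[OF that] by metis
  obtain M1 where "\<forall>s\<in>{0..p}. \<bar>u\<^sub>1 E0 s\<bar> \<le> M1"
    using bd[OF ode_solution_continuous(1)] Ud by blast
  moreover obtain M2 where "\<forall>s\<in>{0..p}. \<bar>v\<^sub>1 E0 s\<bar> \<le> M2"
    using bd[OF ode_solution_continuous(2)] Ud by blast
  moreover obtain M3 where "\<forall>s\<in>{0..p}. \<bar>u\<^sub>2 E0 s\<bar> \<le> M3"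
    using bd[OF ode_solution_continuous(1)] Ud by blast
  moreover obtain M4 where "\<forall>s\<in>{0..p}. \<bar>v\<^sub>2 E0 s\<bar> \<le> M4"
    using bd[OF ode_solution_continuous(2)] Ud by blast
  moreover define C where "C = max 1 (max (max M1 M2) (max M3 M4))"
  ultimately have C: "\<And>s. s \<in> {0..p} \<Longrightarrow> \<bar>u\<^sub>1 E0 s\<bar> \<le> C" "\<And>s. s \<in> {0..p} \<Longrightarrow> \<bar>v\<^sub>1 E0 s\<bar> \<le> C"
    "\<And>s. s \<in> {0..p} \<Longrightarrow> \<bar>u\<^sub>2 E0 s\<bar> \<le> C" "\<And>s. s \<in> {0..p} \<Longrightarrow> \<bar>v\<^sub>2 E0 s\<bar> \<le> C" and "C \<ge> 1"
    by (simp_all add: le_max_iff_disj)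
  show "isCont (\<lambda>E. u\<^sub>1 E p + v\<^sub>2 E p) E0"
    unfolding continuous_at_eps_delta
  proof (intro allI impI)
    fix e :: real assume "e > 0"
    \<comment> \<open>The first entry secures the smallness condition, the second the error bound
      with all four sizes equal to \<open>C\<close>. The \<open>+ 1\<close> covers
      \<open>p = 0\<close>.\<close>
    define d where "d = min (1 / (4 * C * C * p + 1)) (e / (8 * C * C * C * p + 1))"
    have nn: "0 \<le> C * C * p" "0 \<le> C * C * C * p" using \<open>C \<ge> 1\<close> \<open>0 \<le> p\<close> by auto
    then have "d > 0" using \<open>e > 0\<close> by (auto simp: d_def intro!: divide_pos_pos add_nonneg_pos)
    show "\<exists>d>0. \<forall>E. dist E E0 < d \<longrightarrow> dist (u\<^sub>1 E p + v\<^sub>2 E p) (u\<^sub>1 E0 p + v\<^sub>2 E0 p) < e"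
    proof (intro exI[of _ d] conjI allI impI \<open>d > 0\<close>)
      fix E assume "dist E E0 < d"
      then have dE: "\<bar>E - E0\<bar> < 1 / (4 * C * C * p + 1)" "\<bar>E - E0\<bar> < e / (8 * C * C * C * p + 1)"
        by (auto simp: d_def dist_real_def)
      then have dE': "\<bar>E - E0\<bar> * (4 * C * C * p + 1) < 1" "\<bar>E - E0\<bar> * (8 * C * C * C * p + 1) < e"
        using nn by (simp_all add: pos_less_divide_eq add_nonneg_pos mult.assoc)
      have "\<bar>(u\<^sub>1 E p + v\<^sub>2 E p) - (u\<^sub>1 E0 p + v\<^sub>2 E0 p)\<bar>
         \<le> 2 * C * (\<bar>E - E0\<bar> * p) * (2 * C * C + C * C + C * C)"
      proof (rule discriminant_perturbation[OF U[of E0]])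
        show "fundamental_system (\<lambda>x. q x - E0 + (E0 - E)) (u\<^sub>1 E) (v\<^sub>1 E) (u\<^sub>2 E) (v\<^sub>2 E)"
          using U[of E] by simp
        show "integral {0..p} (\<lambda>s. \<bar>E0 - E\<bar>) \<le> \<bar>E - E0\<bar> * p"
          using \<open>0 \<le> p\<close> by (simp add: abs_minus_commute mult.commute)
        show "4 * C * C * (\<bar>E - E0\<bar> * p) \<le> 1"
          using dE'(1) by (simp add: algebra_simps)
      qed (use C \<open>0 \<le> p\<close> in \<open>auto intro: loc_integrable_continuous\<close>)
      also have "\<dots> = \<bar>E - E0\<bar> * (8 * C * C * C * p)" by (simp add: algebra_simps)
      also have "\<dots> \<le> \<bar>E - E0\<bar> * (8 * C * C * C * p + 1)" by (intro mult_left_mono) auto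
      finally show "dist (u\<^sub>1 E p + v\<^sub>2 E p) (u\<^sub>1 E0 p + v\<^sub>2 E0 p) < e"
        using dE'(2) by (simp add: dist_real_def)
    qed
  qed
qed

section \<open>High energies and a zero of the discriminant\<close>

lemma free_fundamental_system:
  assumes "k \<noteq> 0"
  shows "fundamental_system (\<lambda>x. - (k\<^sup>2)) (\<lambda>x. cos (k * x)) (\<lambda>x. - k * sin (k * x))
      (\<lambda>x. sin (k * x) / k) (\<lambda>x. cos (k * x))"
  unfolding fundamental_system_def ode_solution_def
  using assms
  by (auto intro!: ac_primitive_C1 derivative_eq_intros continuous_intros simp: power2_eq_square)

lemma discriminant_zero_exists:
  assumes q: "loc_integrable q" and "0 < p"
    and U: "\<And>E. fundamental_system (\<lambda>x. q x - E) (u\<^sub>1 E) (v\<^sub>1 E) (u\<^sub>2 E) (v\<^sub>2 E)"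
  shows "\<exists>E. u\<^sub>1 E p + v\<^sub>2 E p = 0"
proof -
  define R where "R = integral {0..p} (\<lambda>s. \<bar>q s\<bar>)"
  have "R \<ge> 0"
    using q by (auto simp: R_def intro!: integral_nonneg loc_integrable_integrable_on loc_integrable_abs)
  \<comment> \<open>The perturbation error comes out as \<open>8 * R / k\<close>; the threshold
    makes it at most 1 and keeps \<open>k\<close> positive when \<open>R = 0\<close>.\<close>
  have near: "\<bar>(u\<^sub>1 (k\<^sup>2) p + v\<^sub>2 (k\<^sup>2) p) - 2 * cos (k * p)\<bar> \<le> 1" if k: "k \<ge> 8 * R + 1" for k
  proof -
    have "k > 0" using k \<open>R \<ge> 0\<close> by linarith
    have "\<bar>(u\<^sub>1 (k\<^sup>2) p + v\<^sub>2 (k\<^sup>2) p) - (cos (k * p) + cos (k * p))\<bar>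
       \<le> 2 * (1 / k) * R * (2 * 1 * 1 + k * (1 / k) + 1 * 1)"
    proof (rule discriminant_perturbation[OF free_fundamental_system[of k]])
      show "fundamental_system (\<lambda>x. - (k\<^sup>2) + q x) (u\<^sub>1 (k\<^sup>2)) (v\<^sub>1 (k\<^sup>2)) (u\<^sub>2 (k\<^sup>2)) (v\<^sub>2 (k\<^sup>2))"
        using U[of "k\<^sup>2"] by simp
      show "\<bar>sin (k * s) / k\<bar> \<le> 1 / k" for s using \<open>k > 0\<close> by (simp add: abs_divide divide_right_mono)
      show "\<bar>- k * sin (k * p)\<bar> \<le> k" using \<open>k > 0\<close> by (simp add: abs_mult mult_left_le)
      show "4 * 1 * (1 / k) * R \<le> 1" using k \<open>R \<ge> 0\<close> \<open>k > 0\<close> by (simp add: field_simps)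
    qed (use q \<open>0 < p\<close> \<open>k > 0\<close> in \<open>auto simp: R_def\<close>)
    also have "\<dots> = 8 * R / k" using \<open>k > 0\<close> by simp
    also have "\<dots> \<le> 1" using k \<open>R \<ge> 0\<close> \<open>k > 0\<close> by (simp add: divide_le_eq)
    finally show ?thesis by simp
  qed
  obtain m :: nat where m: "real m \<ge> (8 * R + 1) * p" using real_arch_simple by blast
  \<comment> \<open>For \<open>j = 0\<close> and \<open>j = 1\<close> the product
    \<open>k j * p\<close> is an even and the next odd multiple of \<pi>. There the free
    discriminant is 2 and -2, so an error of 1 cannot spoil the sign.\<close>
  define k where "k j = (2 * real m + j) * pi / p" for j :: real
  have k: "k j \<ge> 8 * R + 1" if "j \<ge> 0" for j
  proof -
    have "(8 * R + 1) * p \<le> real m * 1" using m by simp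
    also have "\<dots> \<le> (2 * real m + j) * pi"
      using that pi_gt3 by (intro mult_mono) auto
    finally show ?thesis using \<open>0 < p\<close> by (simp add: k_def pos_le_divide_eq)
  qed
  have kp: "k j * p = 2 * real m * pi + j * pi" for j
    using \<open>0 < p\<close> unfolding k_def by (simp add: distrib_right[symmetric])
  have c: "cos (k 0 * p) = 1" "cos (k 1 * p) = -1"
    unfolding kp cos_add cos_2npi sin_2npi by simp_all
  define D where "D E = u\<^sub>1 E p + v\<^sub>2 E p" for E
  have "D ((k 0)\<^sup>2) \<ge> 0" "D ((k 1)\<^sup>2) \<le> 0"
    using near[OF k[of 0]] near[OF k[of 1]] c by (auto simp: D_def)
  moreover have "continuous_on UNIV D"
    unfolding D_def using q \<open>0 < p\<close> U by (intro discriminant_continuous) auto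
  moreover have "(k 0)\<^sup>2 \<le> (k 1)\<^sup>2"
    using \<open>0 < p\<close> \<open>R \<ge> 0\<close> k[of 0] by (intro power_mono) (auto simp: k_def divide_right_mono)
  ultimately have "\<exists>E. (k 0)\<^sup>2 \<le> E \<and> E \<le> (k 1)\<^sup>2 \<and> D E = 0"
    by (intro IVT2') (auto intro: continuous_on_subset)
  then show ?thesis by (auto simp: D_def)
qed

section \<open>Letter matrices along substitution words\<close>

definition adj2 :: "real^2^2 \<Rightarrow> real^2^2" where
  "adj2 M = vector [vector [M$2$2, - M$1$2], vector [- M$2$1, M$1$1]]"

text \<open>The entrywise sum norm: submultiplicative, above the operator norm, and unchanged by the
  adjugate \<open>adj2\<close>. Inverses of unimodular matrices therefore cost nothing
  extra.\<close>

definition msize :: "real^2^2 \<Rightarrow> real" where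
  "msize M = \<bar>M$1$1\<bar> + \<bar>M$1$2\<bar> + \<bar>M$2$1\<bar> + \<bar>M$2$2\<bar>"

lemma adj2_mult:
  assumes "det M = 1"
  shows "adj2 M ** M = mat 1" "M ** adj2 M = mat 1"
  using assms
  by (auto simp: vec_eq_iff forall_2 adj2_def matrix_matrix_mult_def sum_2 mat_def det_2 algebra_simps)

lemma adj2_matrix_mult: "adj2 (M ** N) = adj2 N ** adj2 M"
  by (auto simp: vec_eq_iff forall_2 adj2_def matrix_matrix_mult_def sum_2 algebra_simps)

lemma msize_nonneg: "msize M \<ge> 0"
  by (simp add: msize_def)

lemma msize_adj2 [simp]: "msize (adj2 M) = msize M"
  by (simp add: msize_def adj2_def)

lemma msize_mult: "msize (M ** N) \<le> msize M * msize N"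
proof -
  have *: "\<bar>a * b + c * d\<bar> \<le> \<bar>a\<bar> * \<bar>b\<bar> + \<bar>c\<bar> * \<bar>d\<bar>" for a b c d :: real
    by (metis abs_mult abs_triangle_ineq)
  have "msize (M ** N) \<le>
      (\<bar>M$1$1\<bar> * \<bar>N$1$1\<bar> + \<bar>M$1$2\<bar> * \<bar>N$2$1\<bar>) + (\<bar>M$1$1\<bar> * \<bar>N$1$2\<bar> + \<bar>M$1$2\<bar> * \<bar>N$2$2\<bar>) +
      (\<bar>M$2$1\<bar> * \<bar>N$1$1\<bar> + \<bar>M$2$2\<bar> * \<bar>N$2$1\<bar>) + (\<bar>M$2$1\<bar> * \<bar>N$1$2\<bar> + \<bar>M$2$2\<bar> * \<bar>N$2$2\<bar>)"
    unfolding msize_def by (simp add: matrix_matrix_mult_def sum_2) (intro add_mono *)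
  also have "\<dots> \<le> msize M * msize N"
    by (simp add: msize_def distrib_left distrib_right)
  finally show ?thesis .
qed

lemma msize_mult_le:
  assumes "msize M \<le> a" "msize N \<le> b"
  shows "msize (M ** N) \<le> a * b"
proof -
  have "0 \<le> a" using assms(1) msize_nonneg[of M] by linarith
  then have "msize M * msize N \<le> a * b"
    using assms msize_nonneg by (intro mult_mono) auto
  then show ?thesis using msize_mult[of M N] by linarith
qed

lemma onorm_le_msize: "onorm (\<lambda>v. M *v v) \<le> msize M"
  using onorm_le_matrix_component_sum[of M] by (simp add: msize_def sum_2)

text \<open>Solutions are propagated from left to right, so the first letter acts first and stands
  rightmost.\<close>

fun word_matrix :: "(letter \<Rightarrow> real^2^2) \<Rightarrow> letter list \<Rightarrow> real^2^2" where
  "word_matrix P [] = mat 1"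
| "word_matrix P (c # w) = word_matrix P w ** P c"

lemma word_matrix_append: "word_matrix P (u @ w) = word_matrix P w ** word_matrix P u"
  by (induction u) (simp_all add: matrix_mul_assoc)

text \<open>Substituting in the word amounts to changing the letter matrices, so iterates are
  evaluated level by level.\<close>

lemma word_matrix_subst:
  "word_matrix P (TM_subst w) = word_matrix (\<lambda>c. word_matrix P (TM_letter c)) w"
  by (induction w) (simp_all add: TM_subst_def word_matrix_append)

lemma det_word_matrix:
  assumes "\<And>c. det (P c) = 1"
  shows "det (word_matrix P w) = 1"
  using assms by (induction w) (simp_all add: det_mul)

lemma traceless_unimodular_square:
  fixes X :: "real^2^2"
  assumes "det X = 1" "X$1$1 + X$2$2 = 0"
  shows "X ** X = - mat 1"
proof -
  have d: "X$2$2 = - X$1$1" using assms(2) by linarith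
  show ?thesis
    using assms(1)
    by (auto simp: vec_eq_iff forall_2 matrix_matrix_mult_def sum_2 mat_def det_2 d algebra_simps)
qed

lemma minus_mat_mult:
  fixes X :: "real^2^2"
  shows "X ** (- mat 1) = - X" "(- X) ** Y = - (X ** Y)"
  by (auto simp: vec_eq_iff forall_2 matrix_matrix_mult_def sum_2 mat_def algebra_simps)

text \<open>The two words are AB BA BA AB and BA AB AB BA. In each the inner square is -1, which
  leaves minus the outer square.\<close>

lemma word_matrix_TM_subst3:
  assumes det: "\<And>c. det (P c) = 1" and tr: "(P B ** P A)$1$1 + (P B ** P A)$2$2 = 0"
  shows "word_matrix P ((TM_subst ^^ 3) [c]) = mat 1"
proof -
  define X Y where "X = P B ** P A" and "Y = P A ** P B"
  have "X$1$1 + X$2$2 = 0" "Y$1$1 + Y$2$2 = 0"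
    using tr by (simp_all add: X_def Y_def matrix_matrix_mult_def sum_2 algebra_simps)
  moreover have "det X = 1" "det Y = 1" by (simp_all add: X_def Y_def det_mul det)
  ultimately have sq: "X ** X = - mat 1" "Y ** Y = - mat 1"
    by (simp_all add: traceless_unimodular_square)
  have "X ** (Y ** Y) ** X = mat 1" "Y ** (X ** X) ** Y = mat 1"
    by (simp_all add: sq minus_mat_mult)
  moreover have "word_matrix P ((TM_subst ^^ 3) [A]) = X ** (Y ** Y) ** X"
    "word_matrix P ((TM_subst ^^ 3) [B]) = Y ** (X ** X) ** Y"
    by (simp_all add: numeral_3_eq_3 word_matrix_subst X_def Y_def matrix_mul_assoc)
  ultimately show ?thesis by (cases c) simp_all
qed

section \<open>Subwords of Thue-Morse words\<close>

lemma TM_subst_append: "(TM_subst ^^ n) (u @ w) = (TM_subst ^^ n) u @ (TM_subst ^^ n) w"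
  by (induction n) (simp_all add: TM_subst_def)

lemma TM_subst_power_Nil [simp]: "(TM_subst ^^ n) [] = []"
  by (induction n) (simp_all add: TM_subst_def)

lemma length_TM_subst3: "length ((TM_subst ^^ 3) [c]) = 8"
  by (cases c) (simp_all add: numeral_3_eq_3 TM_subst_def)

text \<open>The image of \<open>A\<close> begins with \<open>A\<close>, so each iterate extends the
  previous one.\<close>

lemma prefix_TM_subst: "prefix ((TM_subst ^^ n) [A]) ((TM_subst ^^ (n + k)) [A])"
proof (induction k)
  case (Suc k)
  have "(TM_subst ^^ (n + Suc k)) [A] = (TM_subst ^^ (n + k)) (TM_subst [A])"
    by (simp add: funpow_swap1)
  also have "\<dots> = (TM_subst ^^ (n + k)) [A] @ (TM_subst ^^ (n + k)) [B]"
    using TM_subst_append[of "n + k" "[A]" "[B]"] by (simp add: TM_subst_def)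
  finally show ?case using Suc by (metis prefix_order.trans prefixI)
qed simp

text \<open>Complete blocks of 8 letters have matrix 1 and drop out; what remains is a prefix of a
  single block.\<close>

lemma word_matrix_prefix:
  assumes one: "\<And>c. word_matrix P ((TM_subst ^^ 3) [c]) = mat 1"
    and "prefix u ((TM_subst ^^ 3) v)"
  shows "\<exists>u'. length u' \<le> 8 \<and> word_matrix P u' = word_matrix P u"
  using assms(2)
proof (induction v arbitrary: u)
  case Nil
  then show ?case by (intro exI[of _ "[]"]) simp
next
  case (Cons c v)
  have "prefix u ((TM_subst ^^ 3) [c] @ (TM_subst ^^ 3) v)"
    using Cons.prems TM_subst_append[of 3 "[c]" v] by simp
  then consider "prefix u ((TM_subst ^^ 3) [c])"
    | u' where "u = (TM_subst ^^ 3) [c] @ u'" "prefix u' ((TM_subst ^^ 3) v)"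
    unfolding prefix_append by blast
  then show ?case
  proof cases
    case 1
    then have "length u \<le> 8" using prefix_length_le length_TM_subst3 by metis
    then show ?thesis by blast
  next
    case 2
    then have "word_matrix P u = word_matrix P u'" by (simp add: word_matrix_append one)
    then show ?thesis using Cons.IH[OF 2(2)] by simp
  qed
qed

text \<open>The factor 2 is the size of the identity matrix, the value at the empty word.\<close>

lemma msize_word_matrix:
  assumes "\<And>c. msize (P c) \<le> C" "C \<ge> 1"
  shows "msize (word_matrix P w) \<le> 2 * C ^ length w"
proof (induction w)
  case (Cons c w)
  then show ?case using msize_mult_le[OF Cons assms(1)[of c]] by (simp add: mult_ac)
qed (simp add: msize_def mat_def)

text \<open>A subword is a prefix with a shorter prefix removed, so its matrix is one prefix matrix
  times the inverse of another, and both are bounded independently of their length.\<close>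

lemma Omega_TM_word_matrix_bounded:
  assumes det: "\<And>c. det (P c) = 1" and tr: "(P B ** P A)$1$1 + (P B ** P A)$2$2 = 0"
  shows "\<exists>D>0. \<forall>\<omega>\<in>Omega_TM. \<forall>i j. msize (word_matrix P (map \<omega> [i..j])) \<le> D"
proof -
  note one = word_matrix_TM_subst3[OF det tr]
  define C where "C = 1 + msize (P A) + msize (P B)"
  have C: "msize (P c) \<le> C" "C \<ge> 1" for c
    using msize_nonneg[of "P A"] msize_nonneg[of "P B"] by (cases c; simp add: C_def)+
  define K where "K = 2 * C ^ 8"
  have pre: "msize (word_matrix P u) \<le> K" if "prefix u ((TM_subst ^^ 3) v)" for u v
  proof -
    obtain u' where u': "length u' \<le> 8" "word_matrix P u' = word_matrix P u"
      using word_matrix_prefix[OF one \<open>prefix u _\<close>] by blast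
    have "msize (word_matrix P u') \<le> 2 * C ^ length u'" by (rule msize_word_matrix) (use C in auto)
    also have "\<dots> \<le> 2 * C ^ 8" using C(2) u'(1) by (simp add: power_increasing)
    finally show ?thesis using u'(2) by (simp add: K_def)
  qed
  have "msize (word_matrix P (map \<omega> [i..j])) \<le> K * K" if \<omega>: "\<omega> \<in> Omega_TM" for \<omega> i j
  proof -
    obtain n where n: "sublist (map \<omega> [i..j]) ((TM_subst ^^ n) [A])"
      using \<omega> unfolding Omega_TM_def by blast
    \<comment> \<open>Three further substitutions give a concatenation of 8-letter blocks for every
      \<open>n\<close>, also for \<open>n < 3\<close>.\<close>
    have "prefix ((TM_subst ^^ n) [A]) ((TM_subst ^^ 3) ((TM_subst ^^ n) [A]))"
      using prefix_TM_subst[of n 3] by (metis add.commute comp_apply funpow_add)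
    then obtain zs where "(TM_subst ^^ 3) ((TM_subst ^^ n) [A]) = (TM_subst ^^ n) [A] @ zs"
      by (rule prefixE)
    moreover obtain xs ys where "(TM_subst ^^ n) [A] = xs @ map \<omega> [i..j] @ ys"
      using n unfolding sublist_def by blast
    ultimately have eq: "(TM_subst ^^ 3) ((TM_subst ^^ n) [A]) = xs @ map \<omega> [i..j] @ ys @ zs" by simp
    have "msize (word_matrix P xs) \<le> K" "msize (word_matrix P (xs @ map \<omega> [i..j])) \<le> K"
      by (rule pre[of _ "(TM_subst ^^ n) [A]"], simp add: eq)+
    then have "msize (word_matrix P (xs @ map \<omega> [i..j]) ** adj2 (word_matrix P xs)) \<le> K * K"
      by (intro msize_mult_le) simp_all
    moreover have "word_matrix P (xs @ map \<omega> [i..j]) ** adj2 (word_matrix P xs) = word_matrix P (map \<omega> [i..j])"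
      by (simp add: word_matrix_append adj2_mult det_word_matrix det flip: matrix_mul_assoc)
    ultimately show ?thesis by simp
  qed
  moreover have "K * K > 0" using C(2) by (simp add: K_def)
  ultimately show ?thesis by blast
qed

section \<open>Fundamental matrices and transfer matrices\<close>

definition fundamental_matrix :: "(real \<Rightarrow> real) \<Rightarrow> (real \<Rightarrow> real^2^2) \<Rightarrow> bool" where
  "fundamental_matrix q F \<longleftrightarrow> fundamental_system q
     (\<lambda>x. F x $ 1 $ 1) (\<lambda>x. F x $ 2 $ 1) (\<lambda>x. F x $ 1 $ 2) (\<lambda>x. F x $ 2 $ 2)"

definition propagator :: "(real \<Rightarrow> real) \<Rightarrow> real \<Rightarrow> real^2^2" where
  "propagator q = (SOME F. fundamental_matrix q F)"

lemma fundamental_matrix_propagator: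
  assumes "loc_integrable q"
  shows "fundamental_matrix q (propagator q)"
proof -
  obtain \<phi>\<^sub>1 \<psi>\<^sub>1 where 1: "ode_solution q \<phi>\<^sub>1 \<psi>\<^sub>1" "\<phi>\<^sub>1 0 = 1" "\<psi>\<^sub>1 0 = 0"
    using ode_solution_exists[OF assms] by blast
  obtain \<phi>\<^sub>2 \<psi>\<^sub>2 where 2: "ode_solution q \<phi>\<^sub>2 \<psi>\<^sub>2" "\<phi>\<^sub>2 0 = 0" "\<psi>\<^sub>2 0 = 1"
    using ode_solution_exists[OF assms] by blast
  have "fundamental_matrix q (\<lambda>x. vector [vector [\<phi>\<^sub>1 x, \<phi>\<^sub>2 x], vector [\<psi>\<^sub>1 x, \<psi>\<^sub>2 x]])"
    using 1 2 by (simp add: fundamental_matrix_def fundamental_system_def)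
  then have "\<exists>F. fundamental_matrix q F" by blast
  then show ?thesis unfolding propagator_def by (rule someI_ex)
qed

lemma fundamental_matrix_0:
  assumes "fundamental_matrix q F"
  shows "F 0 = mat 1"
  using assms by (simp add: fundamental_matrix_def fundamental_system_def vec_eq_iff forall_2 mat_def)

lemma fundamental_matrix_det:
  assumes "fundamental_matrix q F"
  shows "det (F x) = 1"
  using fundamental_system_det[OF assms[unfolded fundamental_matrix_def], of x] by (simp add: det_2)

lemma fundamental_matrix_column:
  assumes "fundamental_matrix q F"
  shows "ode_solution q (\<lambda>x. F x $ 1 $ j) (\<lambda>x. F x $ 2 $ j)"
  using assms exhaust_2[of j] by (auto simp: fundamental_matrix_def fundamental_system_def)

lemma fundamental_matrix_span:
  assumes "fundamental_matrix q F" "ode_solution q u v"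
  shows "vector [u x, v x] = F x *v vector [u 0, v 0]"
  using fundamental_system_span[OF assms(1)[unfolded fundamental_matrix_def] assms(2), of x]
  by (simp add: vec_eq_iff forall_2 matrix_vector_mult_def sum_2)

text \<open>The differentiability conjunct in the almost-everywhere clause is what gives
  \<open>deriv (deriv u)\<close> a meaning; with it, the clause is pointwise a
  \<open>has_real_derivative\<close> statement.\<close>

lemma schroedinger_solution_iff:
  "schroedinger_solution V E u \<longleftrightarrow> ode_solution (\<lambda>x. V x - E) u (deriv u)"
proof -
  have eq: "(deriv u differentiable at x \<and> - deriv (deriv u) x + V x * u x = E * u x) \<longleftrightarrow>
      (deriv u has_real_derivative (V x - E) * u x) (at x)" for x
  proof
    assume *: "deriv u differentiable at x \<and> - deriv (deriv u) x + V x * u x = E * u x"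
    then have "deriv (deriv u) x = (V x - E) * u x" by (simp add: algebra_simps)
    then show "(deriv u has_real_derivative (V x - E) * u x) (at x)"
      using * DERIV_deriv_iff_real_differentiable by metis
  next
    assume *: "(deriv u has_real_derivative (V x - E) * u x) (at x)"
    then have "deriv (deriv u) x = (V x - E) * u x" by (rule DERIV_imp_deriv)
    then show "deriv u differentiable at x \<and> - deriv (deriv u) x + V x * u x = E * u x"
      using * real_differentiable_def by (auto simp: algebra_simps)
  qed
  show ?thesis
    by (simp only: schroedinger_solution_def ode_solution_def ac_primitive_def eq
        DERIV_deriv_iff_real_differentiable)
qed

lemma ode_solution_imp_schroedinger_solution:
  assumes "ode_solution (\<lambda>x. V x - E) u v"
  shows "schroedinger_solution V E u" "deriv u = v"
proof -
  show "deriv u = v" using assms by (auto simp: ode_solution_def intro: DERIV_imp_deriv)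
  then show "schroedinger_solution V E u" using assms by (simp add: schroedinger_solution_iff)
qed

text \<open>Resolves the definite description: the span formula shows that the product qualifies.
  Conversely the columns of \<open>F\<close> are solutions themselves, so a candidate
  \<open>M\<close> satisfies \<open>M ** F y = F x\<close> with \<open>F y\<close>
  invertible.\<close>

lemma transfer_matrix_eq:
  assumes F: "fundamental_matrix (\<lambda>x. potential l V \<omega> x - E) F"
  shows "transfer_matrix l V \<omega> x y E = F x ** adj2 (F y)"
  unfolding transfer_matrix_def
proof (rule the_equality)
  have det: "det (F z) = 1" for z by (rule fundamental_matrix_det[OF F])
  show "\<forall>u. schroedinger_solution (potential l V \<omega>) E u \<longrightarrow>
      (F x ** adj2 (F y)) *v vector [u y, deriv u y] = vector [u x, deriv u x]"
  proof (intro allI impI)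
    fix u assume "schroedinger_solution (potential l V \<omega>) E u"
    then have u: "vector [u z, deriv u z] = F z *v vector [u 0, deriv u 0]" for z
      by (intro fundamental_matrix_span[OF F]) (simp add: schroedinger_solution_iff)
    have "(F x ** adj2 (F y)) *v (F y *v w) = F x *v w" for w
      by (simp add: matrix_vector_mul_assoc adj2_mult det flip: matrix_mul_assoc)
    then show "(F x ** adj2 (F y)) *v vector [u y, deriv u y] = vector [u x, deriv u x]"
      unfolding u[of x] u[of y] .
  qed
  fix M :: "real^2^2"
  assume M: "\<forall>u. schroedinger_solution (potential l V \<omega>) E u \<longrightarrow>
      M *v vector [u y, deriv u y] = vector [u x, deriv u x]"
  have col: "M *v vector [F y $ 1 $ j, F y $ 2 $ j] = vector [F x $ 1 $ j, F x $ 2 $ j]" for j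
    using M ode_solution_imp_schroedinger_solution[OF fundamental_matrix_column[OF F, of j]] by metis
  have "M ** F y = F x"
    using col[of 1] col[of 2]
    by (simp add: vec_eq_iff forall_2 matrix_vector_mult_def matrix_matrix_mult_def sum_2)
  then have "F x ** adj2 (F y) = M ** (F y ** adj2 (F y))" by (simp add: matrix_mul_assoc)
  then show "M = F x ** adj2 (F y)" by (simp add: adj2_mult det)
qed

section \<open>Translation and local comparison of solutions\<close>

lemma loc_integrable_translate:
  assumes "loc_integrable f"
  shows "loc_integrable (\<lambda>x. f (c + x))"
  unfolding loc_integrable_def
proof (intro allI)
  fix a b
  have "f absolutely_integrable_on {a + c..b + c}" using assms by (simp add: loc_integrable_def)
  then show "(\<lambda>x. f (c + x)) absolutely_integrable_on {a..b}"
    using integrable_shift_real_ivl[of f "a + c" "b + c" c] integrable_shift_real_ivl[of "\<lambda>x. norm (f x)" "a + c" "b + c" c]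
    by (simp add: absolutely_integrable_on_def add.commute)
qed

text \<open>Instead of translating divisions and null sets, the shifted \<open>v\<close> is
  rewritten as \<open>v c\<close> plus the indefinite integral of the shifted right-hand side, which
  is a primitive by construction.\<close>

lemma ode_solution_translate:
  assumes q: "loc_integrable q" and u: "ode_solution q u v"
  shows "ode_solution (\<lambda>x. q (c + x)) (\<lambda>x. u (c + x)) (\<lambda>x. v (c + x))"
proof -
  define f where "f x = q x * u x" for x
  have f: "loc_integrable f"
    unfolding f_def by (rule loc_integrable_mult_continuous[OF q ode_solution_continuous(1)[OF u]])
  have f': "loc_integrable (\<lambda>x. f (c + x))" by (rule loc_integrable_translate[OF f])
  have v: "ac_primitive v f" using u by (simp add: ode_solution_def f_def[abs_def])
  have step: "v (c + y) - v (c + x) = indef_integral (\<lambda>x. f (c + x)) y - indef_integral (\<lambda>x. f (c + x)) x"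
    if "x \<le> y" for x y
  proof (rule has_integral_unique)
    show "((\<lambda>x. f (c + x)) has_integral v (c + y) - v (c + x)) {x..y}"
      using has_integral_shift_real_ivl[OF ac_primitive_has_integral[OF v, of "c + x" "c + y"], of c] that
      by (simp add: add.commute)
    show "((\<lambda>x. f (c + x)) has_integral
        indef_integral (\<lambda>x. f (c + x)) y - indef_integral (\<lambda>x. f (c + x)) x) {x..y}"
      by (rule indef_integral_has_integral[OF f' that])
  qed
  have "v (c + x) = v c + indef_integral (\<lambda>x. f (c + x)) x" for x
    using step[of 0 x] step[of x 0] by (cases "0 \<le> x") auto
  then have "ac_primitive (\<lambda>x. v (c + x)) (\<lambda>x. q (c + x) * u (c + x))"
    using ac_primitive_shift[OF ac_primitive_indef_integral[OF f'], of "v c"] by (simp add: f_def)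
  moreover have "((\<lambda>x. u (c + x)) has_real_derivative v (c + x)) (at x)" for x
    using u DERIV_shift[of u "v (c + x)" x c] by (simp add: ode_solution_def add.commute)
  ultimately show ?thesis by (simp add: ode_solution_def)
qed

text \<open>The columns of \<open>F\<close> shifted by \<open>c\<close> solve an equation whose
  coefficient agrees with \<open>q'\<close> on the interval, so \<open>G\<close> propagates
  them.\<close>

lemma fundamental_matrix_local_cocycle:
  assumes q: "loc_integrable q" and F: "fundamental_matrix q F" and G: "fundamental_matrix q' G"
    and eq: "\<And>t. t \<in> {0<..<p} \<Longrightarrow> q (c + t) = q' t" and t: "t \<in> {0..p}"
  shows "F (c + t) = G t ** F c"
proof -
  have "F (c + t) $ 1 $ j = G t $ 1 $ 1 * F c $ 1 $ j + G t $ 1 $ 2 * F c $ 2 $ j \<and>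
        F (c + t) $ 2 $ j = G t $ 2 $ 1 * F c $ 1 $ j + G t $ 2 $ 2 * F c $ 2 $ j" for j
    using fundamental_system_span_local[OF G[unfolded fundamental_matrix_def]
        ode_solution_translate[OF q fundamental_matrix_column[OF F, of j], of c], of p t] eq t by simp
  then show ?thesis
    by (simp add: vec_eq_iff forall_2 matrix_matrix_mult_def sum_2)
qed

lemma fundamental_matrix_bounded:
  assumes F: "fundamental_matrix q F"
  shows "\<exists>K. \<forall>t\<in>{0..p}. msize (F t) \<le> K"
proof -
  have "continuous_on {0..p} (\<lambda>t. F t $ i $ j)" for i j
    using ode_solution_continuous[OF fundamental_matrix_column[OF F, of j]] exhaust_2[of i] by auto
  then have "continuous_on {0..p} (\<lambda>t. msize (F t))"
    unfolding msize_def by (intro continuous_on_add continuous_on_rabs)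
  from continuous_on_interval_bounded[OF this] show ?thesis by (metis abs_le_D1)
qed

section \<open>Potentials built from letters\<close>

locale letter_potentials =
  fixes l :: "letter \<Rightarrow> real" and V :: "letter \<Rightarrow> real \<Rightarrow> real"
  assumes l_pos: "l c > 0" and V_integrable: "V c absolutely_integrable_on {0<..<l c}"
begin

section \<open>Geometry of the blocks and integrability of the potential\<close>

lemma block_start_0 [simp]: "block_start l \<omega> 0 = 0"
  by (simp add: block_start_def)

lemma block_start_Suc: "block_start l \<omega> (n + 1) = block_start l \<omega> n + l (\<omega> n)"
proof (cases "0 \<le> n")
  case True
  then have "{0..<n + 1} = insert n {0..<n}" by auto
  then show ?thesis using True by (simp add: block_start_def)
next
  case False
  then have "{n..<0} = insert n {n + 1..<0}" by auto
  then show ?thesis using False by (auto simp: block_start_def)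
qed

lemma block_start_less: "m < n \<Longrightarrow> block_start l \<omega> m < block_start l \<omega> n"
proof (induction rule: int_gr_induct)
  case base
  then show ?case using l_pos[of "\<omega> m"] by (simp add: block_start_Suc)
next
  case (step n)
  then show ?case using l_pos[of "\<omega> n"] by (simp add: block_start_Suc)
qed

lemma block_start_le: "m \<le> n \<Longrightarrow> block_start l \<omega> m \<le> block_start l \<omega> n"
  using block_start_less[of m n \<omega>] by (cases "m = n") auto

text \<open>With two letters the block lengths have a common lower bound, so the blocks exhaust the
  line in both directions.\<close>

lemma block_start_linear_growth:
  defines "c \<equiv> min (l A) (l B)"
  shows "real N * c \<le> block_start l \<omega> (int N)" "block_start l \<omega> (- int N) \<le> - (real N * c)"
proof -
  have c: "c \<le> l d" for d by (cases d) (auto simp: c_def)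
  show "real N * c \<le> block_start l \<omega> (int N)"
  proof (induction N)
    case (Suc N)
    then show ?case using block_start_Suc[of \<omega> "int N"] c[of "\<omega> (int N)"]
      by (simp add: algebra_simps)
  qed simp
  show "block_start l \<omega> (- int N) \<le> - (real N * c)"
  proof (induction N)
    case (Suc N)
    then show ?case using block_start_Suc[of \<omega> "- int N - 1"] c[of "\<omega> (- int N - 1)"]
      by (simp add: algebra_simps minus_diff_commute)
  qed simp
qed

lemma block_start_unbounded: "\<exists>N. block_start l \<omega> (- int N) < a \<and> b < block_start l \<omega> (int N)"
proof -
  define c where "c = min (l A) (l B)"
  have "c > 0" using l_pos by (simp add: c_def)
  then obtain N where N: "max (- a) b < real N * c"
    using reals_Archimedean3 by blast
  then show ?thesis
    using block_start_linear_growth(1)[where N = N and \<omega> = \<omega>] block_start_linear_growth(2)[where N = N and \<omega> = \<omega>] by (intro exI[of _ N]) (auto simp: c_def)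
qed

lemma block_containing: "\<exists>n. block_start l \<omega> n \<le> x \<and> x < block_start l \<omega> (n + 1)"
proof -
  have *: "\<exists>n. block_start l \<omega> n \<le> x \<and> x < block_start l \<omega> (n + 1)"
    if "block_start l \<omega> m \<le> x" "x < block_start l \<omega> (m + int N)" for m N
    using that
  proof (induction N)
    case (Suc N)
    show ?case
    proof (cases "x < block_start l \<omega> (m + int N)")
      case False
      then show ?thesis using Suc.prems by (intro exI[of _ "m + int N"]) (simp add: algebra_simps)
    qed (use Suc in blast)
  qed simp
  obtain N where "block_start l \<omega> (- int N) < x" "x < block_start l \<omega> (int N)"
    using block_start_unbounded by blast
  then show ?thesis using *[of "- int N" "2 * N"] by simp
qed

lemma potential_block:
  assumes "block_start l \<omega> n \<le> x" "x < block_start l \<omega> (n + 1)"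
  shows "potential l V \<omega> x = V (\<omega> n) (x - block_start l \<omega> n)"
proof -
  have "block_index l \<omega> x = n"
    unfolding block_index_def
  proof (rule the_equality)
    fix m assume m: "block_start l \<omega> m \<le> x \<and> x < block_start l \<omega> (m + 1)"
    show "m = n"
    proof (rule ccontr)
      assume "m \<noteq> n"
      then consider "m + 1 \<le> n" | "n + 1 \<le> m" by linarith
      then show False
        using block_start_le[of "m + 1" n \<omega>] block_start_le[of "n + 1" m \<omega>] m assms by cases auto
    qed
  qed (use assms in simp)
  then show ?thesis by (simp add: potential_def)
qed

text \<open>\<open>V c\<close> is unconstrained outside the open block. Extending by 0 gives a
  locally integrable function on the line, to which global existence applies.\<close>

definition letter_potential :: "letter \<Rightarrow> real \<Rightarrow> real" where
  "letter_potential c t = (if t \<in> {0<..<l c} then V c t else 0)"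

lemma loc_integrable_letter_potential: "loc_integrable (letter_potential c)"
proof -
  have "letter_potential c absolutely_integrable_on UNIV"
    using V_integrable[of c] unfolding letter_potential_def absolutely_integrable_restrict_UNIV .
  then show ?thesis unfolding loc_integrable_def by (blast intro: absolutely_integrable_on_subinterval)
qed

lemma potential_eq_letter_potential:
  assumes "t \<in> {0<..<l (\<omega> n)}"
  shows "potential l V \<omega> (block_start l \<omega> n + t) = letter_potential (\<omega> n) t"
  using potential_block[of \<omega> n "block_start l \<omega> n + t"] assms
  by (simp add: letter_potential_def block_start_Suc)

text \<open>On each block the potential is a translated \<open>letter_potential\<close> except at
  the endpoints, and finitely many blocks cover a bounded interval.\<close>

lemma loc_integrable_potential: "loc_integrable (potential l V \<omega>)"
  unfolding loc_integrable_def
proof (intro allI)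
  fix a b :: real
  let ?s = "block_start l \<omega>" and ?W = "potential l V \<omega>"
  have block: "?W absolutely_integrable_on {?s n..?s (n + 1)}" for n
  proof (rule absolutely_integrable_spike)
    show "(\<lambda>x. letter_potential (\<omega> n) (- ?s n + x)) absolutely_integrable_on {?s n..?s (n + 1)}"
      using loc_integrable_translate[OF loc_integrable_letter_potential, of "\<omega> n" "- ?s n"]
      unfolding loc_integrable_def by blast
    show "?W x = letter_potential (\<omega> n) (- ?s n + x)"
      if "x \<in> {?s n..?s (n + 1)} - {?s n, ?s (n + 1)}" for x
      using potential_eq_letter_potential[of "x - ?s n" \<omega> n] that by (simp add: block_start_Suc)
  qed simp
  have "?W absolutely_integrable_on {?s m..?s (m + int N)}" for m N
  proof (induction N)
    case (Suc N)
    have le: "?s m \<le> ?s (m + int N)" "?s (m + int N) \<le> ?s (m + int N + 1)"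
      by (rule block_start_le; simp)+
    have "?W absolutely_integrable_on {?s m..?s (m + int N + 1)}"
      using Suc block[of "m + int N"] Henstock_Kurzweil_Integration.integrable_combine[OF le]
      unfolding absolutely_integrable_on_def by blast
    then show ?case by (simp add: algebra_simps)
  qed (simp add: absolutely_integrable_negligible)
  moreover obtain N where "?s (- int N) < a" "b < ?s (int N)" using block_start_unbounded by blast
  moreover have "{a..b} \<subseteq> {?s (- int N)..?s (- int N + int (2 * N))}" using calculation(2,3) by auto
  ultimately show "?W absolutely_integrable_on {a..b}"
    by (blast intro: absolutely_integrable_on_subinterval)
qed

section \<open>Propagators of single letters and of the line\<close>

lemma loc_integrable_shift_energy:
  assumes "loc_integrable q"
  shows "loc_integrable (\<lambda>x. q x - E)"
  by (rule loc_integrable_diff[OF assms]) (auto intro: loc_integrable_continuous)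

definition block_propagator :: "real \<Rightarrow> letter \<Rightarrow> real \<Rightarrow> real^2^2" where
  "block_propagator E c = propagator (\<lambda>t. letter_potential c t - E)"

definition letter_matrix :: "real \<Rightarrow> letter \<Rightarrow> real^2^2" where
  "letter_matrix E c = block_propagator E c (l c)"

definition line_propagator :: "(int \<Rightarrow> letter) \<Rightarrow> real \<Rightarrow> real \<Rightarrow> real^2^2" where
  "line_propagator \<omega> E = propagator (\<lambda>x. potential l V \<omega> x - E)"

lemma fundamental_block_propagator:
  "fundamental_matrix (\<lambda>t. letter_potential c t - E) (block_propagator E c)"
  unfolding block_propagator_def
  by (intro fundamental_matrix_propagator loc_integrable_shift_energy loc_integrable_letter_potential)

lemma fundamental_line_propagator:
  "fundamental_matrix (\<lambda>x. potential l V \<omega> x - E) (line_propagator \<omega> E)"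
  unfolding line_propagator_def
  by (intro fundamental_matrix_propagator loc_integrable_shift_energy loc_integrable_potential)

lemma det_letter_matrix: "det (letter_matrix E c) = 1"
  unfolding letter_matrix_def by (rule fundamental_matrix_det[OF fundamental_block_propagator])

text \<open>Within a block the sequence enters only through its letter, which is the source of
  uniformity in \<open>\<omega>\<close>.\<close>

lemma line_propagator_block:
  assumes "t \<in> {0..l (\<omega> n)}"
  shows "line_propagator \<omega> E (block_start l \<omega> n + t)
    = block_propagator E (\<omega> n) t ** line_propagator \<omega> E (block_start l \<omega> n)"
  by (rule fundamental_matrix_local_cocycle[OF _ fundamental_line_propagator fundamental_block_propagator _ assms])
    (auto intro: loc_integrable_shift_energy loc_integrable_potential simp: potential_eq_letter_potential)

text \<open>Between the two block starts lie the blocks \<open>i\<close> to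
  \<open>i + int N - 1\<close>; for \<open>N = 0\<close> the word is empty.\<close>

lemma line_propagator_word:
  "line_propagator \<omega> E (block_start l \<omega> (i + int N))
    = word_matrix (letter_matrix E) (map \<omega> [i..i + int N - 1]) ** line_propagator \<omega> E (block_start l \<omega> i)"
proof (induction N)
  case (Suc N)
  have "line_propagator \<omega> E (block_start l \<omega> (i + int N + 1))
      = letter_matrix E (\<omega> (i + int N)) ** line_propagator \<omega> E (block_start l \<omega> (i + int N))"
    using line_propagator_block[of "l (\<omega> (i + int N))" \<omega> "i + int N" E] l_pos[of "\<omega> (i + int N)"]
    by (simp add: block_start_Suc letter_matrix_def)
  moreover have "[i..i + int N] = [i..i + int N - 1] @ [i + int N]" by (rule upto_rec2) simp
  ultimately show ?case using Suc by (simp add: word_matrix_append matrix_mul_assoc algebra_simps)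
qed simp

text \<open>Cutting at the left ends of the blocks of \<open>x\<close> and \<open>y\<close> leaves a
  word matrix or its inverse, bounded by \<open>D\<close>, and two partial blocks at a cost of
  \<open>K\<close> each.\<close>

lemma msize_transfer_matrix_le:
  assumes D: "\<And>i j. msize (word_matrix (letter_matrix E) (map \<omega> [i..j])) \<le> D"
    and K: "\<And>c t. t \<in> {0..l c} \<Longrightarrow> msize (block_propagator E c t) \<le> K"
  shows "msize (transfer_matrix l V \<omega> x y E) \<le> K * D * K"
proof -
  let ?F = "line_propagator \<omega> E" and ?s = "block_start l \<omega>"
  have det: "det (?F z) = 1" for z by (rule fundamental_matrix_det[OF fundamental_line_propagator])
  have loc: "\<exists>n t. z = ?s n + t \<and> t \<in> {0..l (\<omega> n)}" for z
  proof -
    obtain n where "?s n \<le> z" "z < ?s (n + 1)" using block_containing by blast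
    then show ?thesis by (intro exI[of _ n] exI[of _ "z - ?s n"]) (simp add: block_start_Suc)
  qed
  obtain j t where x: "x = ?s j + t" "t \<in> {0..l (\<omega> j)}" using loc by blast
  obtain i t' where y: "y = ?s i + t'" "t' \<in> {0..l (\<omega> i)}" using loc by blast
  have word: "?F (?s n) ** adj2 (?F (?s m)) = word_matrix (letter_matrix E) (map \<omega> [m..n - 1])"
    if "m \<le> n" for m n
    using line_propagator_word[of \<omega> E m "nat (n - m)"] that
    by (simp add: adj2_mult det flip: matrix_mul_assoc)
  have "msize (?F (?s j) ** adj2 (?F (?s i))) \<le> D"
  proof (cases "i \<le> j")
    case True
    then show ?thesis using word D by simp
  next
    \<comment> \<open>The word is traversed backwards: the inverse of a word matrix is its adjugate,
      which has the same size.\<close>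
    case False
    have "adj2 (adj2 M) = M" for M by (simp add: adj2_def vec_eq_iff forall_2)
    then have "?F (?s j) ** adj2 (?F (?s i)) = adj2 (?F (?s i) ** adj2 (?F (?s j)))"
      by (simp add: adj2_matrix_mult)
    then show ?thesis using False word[of j i] D by simp
  qed
  then have "msize (block_propagator E (\<omega> j) t ** (?F (?s j) ** adj2 (?F (?s i))) ** adj2 (block_propagator E (\<omega> i) t'))
      \<le> K * D * K"
    using K x(2) y(2) by (intro msize_mult_le) simp_all
  moreover have "transfer_matrix l V \<omega> x y E
      = block_propagator E (\<omega> j) t ** (?F (?s j) ** adj2 (?F (?s i))) ** adj2 (block_propagator E (\<omega> i) t')"
    unfolding transfer_matrix_eq[OF fundamental_line_propagator] x(1) y(1)
      line_propagator_block[of t \<omega> j, OF x(2)] line_propagator_block[of t' \<omega> i, OF y(2)] adj2_matrix_mult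
    by (simp add: matrix_mul_assoc)
  ultimately show ?thesis by simp
qed

text \<open>The product of the two letter matrices is the period map of any sequence that starts with
  \<open>A\<close> and \<open>B\<close>, which makes the discriminant of that sequence applicable.\<close>

lemma traceless_energy_exists:
  "\<exists>E. (letter_matrix E B ** letter_matrix E A)$1$1 + (letter_matrix E B ** letter_matrix E A)$2$2 = 0"
proof -
  \<comment> \<open>Only the letters at 0 and 1 lie between 0 and \<open>p\<close>, so
    \<open>p = l A + l B\<close>.\<close>
  define \<omega> where "\<omega> n = (if n = 0 then A else B)" for n :: int
  define p where "p = block_start l \<omega> 2"
  have "p > 0" using block_start_less[of 0 2 \<omega>] by (simp add: p_def)
  have F: "line_propagator \<omega> E p = letter_matrix E B ** letter_matrix E A" for E
  proof -
    have "[0..1] = [0, 1::int]" by (simp add: upto.simps)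
    then show ?thesis
      using line_propagator_word[of \<omega> E 0 2] fundamental_matrix_0[OF fundamental_line_propagator[of \<omega> E]]
      by (simp add: p_def \<omega>_def)
  qed
  have "\<exists>E. line_propagator \<omega> E p $ 1 $ 1 + line_propagator \<omega> E p $ 2 $ 2 = 0"
    by (rule discriminant_zero_exists[OF loc_integrable_potential \<open>p > 0\<close>
          fundamental_line_propagator[unfolded fundamental_matrix_def]])
  then show ?thesis by (simp add: F)
qed

end

theorem theorem5:
  fixes l :: "letter \<Rightarrow> real" and V :: "letter \<Rightarrow> real \<Rightarrow> real"
  assumes "l A > 0" and "l B > 0"
    and "V A absolutely_integrable_on {0<..<l A}"
    and "V B absolutely_integrable_on {0<..<l B}"
  shows "\<exists>E0 :: real. \<exists>C>0. \<forall>\<omega>\<in>Omega_TM. \<forall>x y.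
           onorm (\<lambda>v. transfer_matrix l V \<omega> x y E0 *v v) \<le> C"
proof -
  have "l c > 0" "V c absolutely_integrable_on {0<..<l c}" for c
    using assms by (cases c; simp)+
  then interpret letter_potentials l V by unfold_locales
  \<comment> \<open>The energy is fixed by the two letters before any sequence is
    considered.\<close>
  obtain E where E: "(letter_matrix E B ** letter_matrix E A)$1$1 + (letter_matrix E B ** letter_matrix E A)$2$2 = 0"
    using traceless_energy_exists by blast
  obtain D where D: "D > 0" "\<And>\<omega> i j. \<omega> \<in> Omega_TM \<Longrightarrow> msize (word_matrix (letter_matrix E) (map \<omega> [i..j])) \<le> D"
    using Omega_TM_word_matrix_bounded[OF det_letter_matrix E] by blast
  obtain K' where K': "\<And>c t. t \<in> {0..l c} \<Longrightarrow> msize (block_propagator E c t) \<le> K' c"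
  proof -
    have "\<forall>c. \<exists>K. \<forall>t\<in>{0..l c}. msize (block_propagator E c t) \<le> K"
      using fundamental_matrix_bounded[OF fundamental_block_propagator] by blast
    then show thesis using that by metis
  qed
  \<comment> \<open>One bound for partial blocks of either letter; the 1 makes the final constant
    positive.\<close>
  define K where "K = max 1 (max (K' A) (K' B))"
  have K: "msize (block_propagator E c t) \<le> K" if "t \<in> {0..l c}" for c t
    using K'[OF that] by (cases c) (auto simp: K_def)
  have "onorm (\<lambda>v. transfer_matrix l V \<omega> x y E *v v) \<le> K * D * K" if "\<omega> \<in> Omega_TM" for \<omega> x y
    using onorm_le_msize msize_transfer_matrix_le[OF D(2)[OF that] K] by (rule order_trans)
  moreover have "K * D * K > 0" using D(1) by (simp add: K_def)
  ultimately show ?thesis by blast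
qed

end
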